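(* Let $p$ be a prime or the symbol $\infty$, let $G$ be a finite group, and let $(\mathscr L_H)_{H\le G}$ be an admissible family of nonempty sublattices of a finite $G$-lattice $\mathscr L$ (see context). Let $\mathfrak X$ be a subset of $\mathcal S(G,M_{\mathscr L})$ closed under the action of $G$ such that, for every $(U,t)\in\mathfrak X$ and $gU\in W_G(U,t)$, the set $$\{(K,s)\in\mathfrak X\mid(K,s)\geq(\langle g\rangle U,s_{(g,t)})\},\qquad s_{(g,t)}=\inf\{s\in\mathscr L_{\langle g\rangle U}\mid s\geq t\},$$ has a unique minimal element, denoted by $(\overline{\langle g\rangle U},\overline{s_{(g,t)}})$, with respect to the partial order on $\mathcal S(G,M_{\mathscr L})$. Then the sequence $$0\longrightarrow\Omega(G,\mathfrak X)_{(p)}\overset{\varphi^{(p)}_{\mathfrak X}}{\longrightarrow}\widetilde\Omega(G,\mathfrak X)_{(p)}\overset{\psi^{(p)}_{\mathfrak X}}{\longrightarrow}\mathrm{Obs}(G,\mathfrak X)_{(p)}\longrightarrow0$$ of $\mathbb Z_{(p)}$-modules is exact. Moreover, the $\mathbb Z_{(p)}$-module $\Omega(G,\mathfrak X)_{(p)}$ has a $\mathbb Z_{(p)}$-algebra structure such that $\varphi^{(p)}_{\mathfrak X}$ is an injective $\mathbb Z_{(p)}$-algebra homomorphism.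
   Context: Write ${}^gH=gHg^{-1}$. A finite $G$-lattice is a finite lattice $\mathscr L$ with an order-preserving left $G$-action $(g,s)\mapsto{}^gs$. An admissible family consists of nonempty sublattices $\mathscr L_H\subseteq\mathscr L$, $H\leq G$, such that for all $K\le H\leq G$, $g\in G$: (1) $\mathscr L_{{}^gH}=\{{}^gs\mid s\in\mathscr L_H\}$; (2) ${}^hs=s$ for $h\in H$, $s\in\mathscr L_H$; (3) $s\wedge\sup\mathscr L_K\in\mathscr L_K$ for $s\in\mathscr L_H$; (4) $\sup\mathscr L_K\leq\sup\mathscr L_H$. $\mathcal S(G,M_{\mathscr L})=\{(K,s)\mid K\leq G,\ s\in\mathscr L_K\}$ with $G$-action $g.(K,s)=({}^gK,{}^gs)$ and partial order $(U,t)\leq(K,s)\iff U\leq K$ and $t\leq s$. $\mathcal R(G,M_{\mathscr L})$ is a complete set of representatives of the $G$-orbits; $N_G(K,s)$ is the stabilizer of $(K,s)$, $W_G(K,s)=N_G(K,s)/K$, $W_G(K,s)_p$ is a Sylow $p$-subgroup of $W_G(K,s)$ for $p$ prime, and $W_G(K,s)_\infty=W_G(K,s)$. $\mathbb Z_{(p)}$ is the localization of $\mathbb Z$ at $p$, and $\mathbb Z_{(\infty)}=\mathbb Z$. Put $\overline{\mathfrak X}=\mathcal R(G,M_{\mathscr L})\cap\mathfrak X$. $\Omega(G,\mathfrak X)_{(p)}$ is the free $\mathbb Z_{(p)}$-module with basis the symbols $[(G/K)_s]$, $(K,s)\in\overline{\mathfrak X}$ (it is a $\mathbb Z_{(p)}$-submodule,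 not necessarily a subring, of the lattice Burnside ring of $G$, localized at $p$), with $[(G/{}^gK)_{{}^gs}]=[(G/K)_s]$. Further, $\widetilde\Omega(G,\mathfrak X)_{(p)}=\prod_{(K,s)\in\overline{\mathfrak X}}\mathbb Z_{(p)}$ (a ring with componentwise operations) and $\mathrm{Obs}(G,\mathfrak X)_{(p)}=\prod_{(K,s)\in\overline{\mathfrak X}}\mathbb Z_{(p)}/|W_G(K,s)_p|\mathbb Z_{(p)}$. For $(U,t)\in\mathfrak X$ and $(x_{(K,s)})\in\widetilde\Omega(G,\mathfrak X)_{(p)}$, $x_{(U,t)}$ means $x_{(K,s)}$ for the $(K,s)\in\overline{\mathfrak X}$ in the $G$-orbit of $(U,t)$. The maps are the $\mathbb Z_{(p)}$-linear maps $$\varphi^{(p)}_{\mathfrak X}:[(G/H)_s]\mapsto\bigl(|\{gH\in G/H\mid U\leq{}^gH\text{ and }t\leq{}^gs\}|\bigr)_{(U,t)\in\overline{\mathfrak X}},$$ $$\psi^{(p)}_{\mathfrak X}:(x_{(H,s)})_{(H,s)\in\overline{\mathfrak X}}\mapsto\Bigl(\sum_{gU\in W_G(U,t)_p}x_{(\overline{\langle g\rangle U},\overline{s_{(g,t)}})}\bmod|W_G(U,t)_p|\Bigr)_{(U,t)\in\overline{\mathfrak X}}.$$ *)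

theory Defs
  imports
    "HOL-Algebra.Algebra"
    "HOL-Library.Extended_Nat"
    "HOL-Library.Poly_Mapping"
    "HOL-Computational_Algebra.Primes"
begin

section \<open>Admissible families of sublattices of a finite G-lattice\<close>

abbreviation conj_set :: "('g, 'm) monoid_scheme \<Rightarrow> 'g \<Rightarrow> 'g set \<Rightarrow> 'g set" where
  "conj_set G g H \<equiv> (g <#\<^bsub>G\<^esub> H) #>\<^bsub>G\<^esub> (inv\<^bsub>G\<^esub> g)"

locale finite_G_lattice = group_action G UNIV act
  for G :: "('g, 'm) monoid_scheme" (structure)
    and act :: "'g \<Rightarrow> 'l::{finite,lattice} \<Rightarrow> 'l" +
  assumes finite_carrier: "finite (carrier G)"
    and act_mono: "g \<in> carrier G \<Longrightarrow> mono (act g)"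

definition sublattice :: "'l::lattice set \<Rightarrow> bool" where
  "sublattice S \<longleftrightarrow> (\<forall>x\<in>S. \<forall>y\<in>S. inf x y \<in> S \<and> sup x y \<in> S)"

locale admissible_family = finite_G_lattice G act
  for G :: "('g, 'm) monoid_scheme" (structure)
    and act :: "'g \<Rightarrow> 'l::{finite,lattice} \<Rightarrow> 'l"
    and Lf :: "'g set \<Rightarrow> 'l set" +
  assumes nonempty: "subgroup H G \<Longrightarrow> Lf H \<noteq> {}"
    and sublat: "subgroup H G \<Longrightarrow> sublattice (Lf H)"
    and conj: "\<lbrakk>subgroup H G; g \<in> carrier G\<rbrakk> \<Longrightarrow> Lf (conj_set G g H) = {act g s | s. s \<in> Lf H}"
    and fixed: "\<lbrakk>subgroup H G; h \<in> H; s \<in> Lf H\<rbrakk> \<Longrightarrow> act h s = s"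
    and inf_Sup: "\<lbrakk>subgroup H G; subgroup K G; K \<subseteq> H; s \<in> Lf H\<rbrakk>
          \<Longrightarrow> inf s (Sup_fin (Lf K)) \<in> Lf K"
    and Sup_mono: "\<lbrakk>subgroup H G; subgroup K G; K \<subseteq> H\<rbrakk> \<Longrightarrow> Sup_fin (Lf K) \<le> Sup_fin (Lf H)"

section \<open>The G-poset of pairs\<close>

definition pairs :: "('g, 'm) monoid_scheme \<Rightarrow> ('g set \<Rightarrow> 'l set) \<Rightarrow> ('g set \<times> 'l) set" where
  "pairs G Lf = {(K, s). subgroup K G \<and> s \<in> Lf K}"

definition pact ::
  "('g, 'm) monoid_scheme \<Rightarrow> ('g \<Rightarrow> 'l \<Rightarrow> 'l) \<Rightarrow> 'g \<Rightarrow> 'g set \<times> 'l \<Rightarrow> 'g set \<times> 'l" where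
  "pact G act g = (\<lambda>(K, s). (conj_set G g K, act g s))"

definition pair_le :: "'g set \<times> 'l::order \<Rightarrow> 'g set \<times> 'l \<Rightarrow> bool" where
  "pair_le = (\<lambda>(U, t) (K, s). U \<subseteq> K \<and> t \<le> s)"

definition minimal_pair :: "('g set \<times> 'l::order) set \<Rightarrow> 'g set \<times> 'l \<Rightarrow> bool" where
  "minimal_pair A m \<longleftrightarrow> m \<in> A \<and> (\<forall>k\<in>A. pair_le k m \<longrightarrow> k = m)"

definition orbit_reps ::
  "('g, 'm) monoid_scheme \<Rightarrow> ('g \<Rightarrow> 'l \<Rightarrow> 'l) \<Rightarrow> ('g set \<times> 'l) set \<Rightarrow> ('g set \<times> 'l) set \<Rightarrow> bool" where
  "orbit_reps G act S R \<longleftrightarrow> R \<subseteq> S \<and> (\<forall>x\<in>S. \<exists>!r. r \<in> R \<and> r \<in> orbit G (pact G act) x)"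

text \<open>Since \<open>K\<close> is normal in the stabilizer \<open>N\<close> of \<open>(K, s)\<close>, the elements of \<open>Wgrp G act (K, s)\<close>
  (right cosets of \<open>K\<close> in \<open>N\<close>) are also the left cosets \<open>gK\<close>.\<close>

definition Wgrp :: "('g, 'm) monoid_scheme \<Rightarrow> ('g \<Rightarrow> 'l \<Rightarrow> 'l) \<Rightarrow> 'g set \<times> 'l \<Rightarrow> 'g set monoid" where
  "Wgrp G act x = (G\<lparr>carrier := stabilizer G (pact G act) x\<rparr>) Mod (fst x)"

text \<open>\<open>p = \<infinity>\<close> encodes the symbol infinity; otherwise \<open>p = enat q\<close> with \<open>q\<close> prime.\<close>

definition sylow_part :: "enat \<Rightarrow> ('a, 'm) monoid_scheme \<Rightarrow> 'a set \<Rightarrow> bool" where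
  "sylow_part p H P \<longleftrightarrow> (case p of
      \<infinity> \<Rightarrow> P = carrier H
    | enat q \<Rightarrow> subgroup P H \<and> card P = q ^ multiplicity q (order H))"

section \<open>The join of a cyclic subgroup with U, and its closure in \<XX>\<close>

definition cyc_join :: "('g, 'm) monoid_scheme \<Rightarrow> 'g \<Rightarrow> 'g set \<Rightarrow> 'g set" where
  "cyc_join G g U = generate G {g} <#>\<^bsub>G\<^esub> U"

text \<open>For \<open>t \<in> Lf U\<close> and \<open>g\<close> normalizing \<open>U\<close> the set below is nonempty, as it contains the
  supremum of \<open>Lf (cyc_join G g U)\<close>; so \<open>Inf_fin\<close> is the infimum.\<close>

definition lat_inf ::
  "('g, 'm) monoid_scheme \<Rightarrow> ('g set \<Rightarrow> 'l::{finite,lattice} set) \<Rightarrow> 'g \<Rightarrow> 'g set \<times> 'l \<Rightarrow> 'l" where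
  "lat_inf G Lf g = (\<lambda>(U, t). Inf_fin {s \<in> Lf (cyc_join G g U). t \<le> s})"

definition upper_pairs ::
  "('g, 'm) monoid_scheme \<Rightarrow> ('g set \<Rightarrow> 'l::{finite,lattice} set) \<Rightarrow> ('g set \<times> 'l) set
    \<Rightarrow> 'g \<Rightarrow> 'g set \<times> 'l \<Rightarrow> ('g set \<times> 'l) set" where
  "upper_pairs G Lf \<XX> g u = {k \<in> \<XX>. pair_le (cyc_join G g (fst u), lat_inf G Lf g u) k}"

definition closure_pair ::
  "('g, 'm) monoid_scheme \<Rightarrow> ('g set \<Rightarrow> 'l::{finite,lattice} set) \<Rightarrow> ('g set \<times> 'l) set
    \<Rightarrow> 'g \<Rightarrow> 'g set \<times> 'l \<Rightarrow> 'g set \<times> 'l" where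
  "closure_pair G Lf \<XX> g u = (THE m. minimal_pair (upper_pairs G Lf \<XX> g u) m)"

text \<open>The subgroup generated by \<open>g\<close> and \<open>U\<close>, and hence \<open>closure_pair\<close>, depends only on the
  coset of \<open>g\<close>.\<close>

lemma cyc_join_eq_generate:
  assumes "group G" "subgroup U G" "g \<in> carrier G" "conj_set G g U = U"
  shows "cyc_join G g U = generate G (insert g U)"
proof -
  interpret group G by fact
  let ?N = "normalizer G U" and ?C = "generate G {g}"
  let ?GN = "G\<lparr>carrier := ?N\<rparr>"
  have U: "U \<subseteq> carrier G" by (rule subgroup.subset[OF assms(2)])
  have N: "subgroup ?N G" by (rule normalizer_imp_subgroup[OF U])
  have gN: "g \<in> ?N" using assms U by (simp add: normalizer_def stabilizer_def)
  have nor: "U \<lhd> ?GN" by (rule subgroup_in_normalizer[OF assms(2)])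
  have C: "subgroup ?C G" using assms by (intro generate_is_subgroup) auto
  have "?C \<subseteq> ?N" using gN N by (intro generate_subgroup_incl) auto
  then have CN: "subgroup ?C ?GN" using C N by (intro subgroup_incl)
  have "U <#>\<^bsub>?GN\<^esub> ?C = ?C <#>\<^bsub>?GN\<^esub> U"
    by (rule group.commut_normal[OF subgroup_imp_group[OF N] CN nor, symmetric])
  then have comm: "U <#>\<^bsub>G\<^esub> ?C = ?C <#>\<^bsub>G\<^esub> U" by simp
  have "subgroup (U <#>\<^bsub>G\<^esub> ?C) ?GN" by (rule mult_norm_sub_in_sub[OF nor CN N])
  then have sub: "subgroup (?C <#>\<^bsub>G\<^esub> U) G" unfolding comm by (rule incl_subgroup[OF N])
  have g: "g \<in> ?C" by (simp add: generate.incl)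
  have "insert g U \<subseteq> ?C <#>\<^bsub>G\<^esub> U"
  proof (intro subsetI)
    fix x assume "x \<in> insert g U"
    then show "x \<in> ?C <#>\<^bsub>G\<^esub> U"
    proof
      assume "x = g"
      then have "x = g \<otimes>\<^bsub>G\<^esub> \<one>\<^bsub>G\<^esub>" using assms by simp
      then show ?thesis using g subgroup.one_closed[OF assms(2)] unfolding set_mult_def by blast
    next
      assume x: "x \<in> U"
      then have "x = \<one>\<^bsub>G\<^esub> \<otimes>\<^bsub>G\<^esub> x" using U by auto
      then show ?thesis using x subgroup.one_closed[OF C] unfolding set_mult_def by blast
    qed
  qed
  then have "generate G (insert g U) \<subseteq> ?C <#>\<^bsub>G\<^esub> U" using sub by (rule generate_subgroup_incl)
  moreover have "?C <#>\<^bsub>G\<^esub> U \<subseteq> generate G (insert g U)"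
    using mono_generate[of "{g}" "insert g U"]
    by (auto simp: set_mult_def intro: generate.eng generate.incl)
  ultimately show ?thesis by (auto simp: cyc_join_def)
qed

lemma cyc_join_coset:
  assumes "group G" "subgroup U G" "g \<in> carrier G" "conj_set G g U = U"
    and "h \<in> U #>\<^bsub>G\<^esub> g"
  shows "cyc_join G h U = cyc_join G g U"
proof -
  interpret group G by fact
  have U: "U \<subseteq> carrier G" by (rule subgroup.subset[OF assms(2)])
  obtain u where u: "u \<in> U" "h = u \<otimes>\<^bsub>G\<^esub> g" using assms(5) by (auto simp: r_coset_def)
  have uc: "u \<in> carrier G" using u U by auto
  have h: "h \<in> carrier G" using u uc assms(3) by simp
  let ?N = "normalizer G U"
  have N: "subgroup ?N G" by (rule normalizer_imp_subgroup[OF U])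
  have "g \<in> ?N" using assms U by (simp add: normalizer_def stabilizer_def)
  moreover have "u \<in> ?N"
    using u subgroup.subset[OF normal_imp_subgroup[OF subgroup_in_normalizer[OF assms(2)]]]
    by auto
  ultimately have "h \<in> ?N" using u N by (simp add: subgroup.m_closed)
  then have hU: "conj_set G h U = U" using U by (simp add: normalizer_def stabilizer_def)
  have "h \<in> generate G (insert g U)"
    using u by (auto intro: generate.eng generate.incl)
  moreover have "g \<in> generate G (insert h U)"
  proof -
    have "g = (inv\<^bsub>G\<^esub> u) \<otimes>\<^bsub>G\<^esub> h" using u uc assms(3) by (simp add: m_assoc[symmetric])
    moreover have "inv\<^bsub>G\<^esub> u \<in> U" using u assms(2) by (simp add: subgroup.m_inv_closed)
    ultimately show ?thesis by (auto intro: generate.eng generate.incl)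
  qed
  ultimately have "generate G (insert h U) = generate G (insert g U)"
    using U h assms(3)
    by (intro equalityI generate_subgroup_incl generate_is_subgroup) (auto intro: generate.incl)
  then show ?thesis using cyc_join_eq_generate assms hU h by metis
qed

section \<open>Modules\<close>

text \<open>The localization of the integers at \<open>p\<close>, as a subring of the rationals.\<close>

definition Zloc :: "enat \<Rightarrow> rat ring" where
  "Zloc p = \<lparr>carrier = {of_int a / of_int b | a b. b \<noteq> 0 \<and>
               (case p of \<infinity> \<Rightarrow> b = 1 | enat q \<Rightarrow> \<not> int q dvd b)},
             monoid.mult = (*), one = 1, ring.zero = 0, ring.add = (+)\<rparr>"

definition self_module :: "('a, 'm) ring_scheme \<Rightarrow> ('a, 'a) module" where
  "self_module A = \<lparr>carrier = carrier A, monoid.mult = monoid.mult A, one = one A,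
                    ring.zero = ring.zero A, ring.add = ring.add A,
                    smult = monoid.mult A\<rparr>"

definition quot_module :: "('a, 'm) ring_scheme \<Rightarrow> 'a set \<Rightarrow> ('a, 'a set) module" where
  "quot_module A I = \<lparr>carrier = carrier (A Quot I), monoid.mult = monoid.mult (A Quot I),
                      one = one (A Quot I),
                      ring.zero = ring.zero (A Quot I), ring.add = ring.add (A Quot I),
                      smult = (\<lambda>a C. (I +>\<^bsub>A\<^esub> a) \<otimes>\<^bsub>A Quot I\<^esub> C)\<rparr>"

definition prod_module :: "'i set \<Rightarrow> ('i \<Rightarrow> ('a, 'b) module) \<Rightarrow> ('a, 'i \<Rightarrow> 'b) module" where
  "prod_module I M = \<lparr>carrier = (\<Pi>\<^sub>E i\<in>I. carrier (M i)),
                      monoid.mult = (\<lambda>x y. \<lambda>i\<in>I. x i \<otimes>\<^bsub>M i\<^esub> y i),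
                      one = (\<lambda>i\<in>I. \<one>\<^bsub>M i\<^esub>),
                      ring.zero = (\<lambda>i\<in>I. \<zero>\<^bsub>M i\<^esub>),
                      ring.add = (\<lambda>x y. \<lambda>i\<in>I. x i \<oplus>\<^bsub>M i\<^esub> y i),
                      smult = (\<lambda>a x. \<lambda>i\<in>I. a \<odot>\<^bsub>M i\<^esub> x i)\<rparr>"

text \<open>The free module on the symbols indexed by \<open>B\<close>; the symbol of \<open>b \<in> B\<close> is
  \<open>Poly_Mapping.single b 1\<close>. No multiplication is given: the record fields \<open>mult\<close> and \<open>one\<close>
  are left unspecified, and the locale \<open>module\<close> does not refer to them.\<close>

definition free_module :: "enat \<Rightarrow> 'i set \<Rightarrow> (rat, 'i \<Rightarrow>\<^sub>0 rat) module" where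
  "free_module p B = \<lparr>carrier = {f. Poly_Mapping.keys f \<subseteq> B \<and>
                                   (\<forall>b. Poly_Mapping.lookup f b \<in> carrier (Zloc p))},
                      monoid.mult = undefined, one = undefined, ring.zero = 0, ring.add = (+),
                      smult = (\<lambda>a. Poly_Mapping.map (\<lambda>c. a * c))\<rparr>"

definition linear_maps ::
  "('a, 'k) ring_scheme \<Rightarrow> ('a, 'b, 'm) module_scheme \<Rightarrow> ('a, 'c, 'n) module_scheme
    \<Rightarrow> ('b \<Rightarrow> 'c) set" where
  "linear_maps A M N = {f \<in> carrier M \<rightarrow> carrier N.
      (\<forall>x\<in>carrier M. \<forall>y\<in>carrier M. f (x \<oplus>\<^bsub>M\<^esub> y) = f x \<oplus>\<^bsub>N\<^esub> f y) \<and>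
      (\<forall>a\<in>carrier A. \<forall>x\<in>carrier M. f (a \<odot>\<^bsub>M\<^esub> x) = a \<odot>\<^bsub>N\<^esub> f x)}"

definition short_exact_modules ::
  "('a, 'k) ring_scheme \<Rightarrow> ('a, 'b, 'm) module_scheme \<Rightarrow> ('a, 'c, 'n) module_scheme
    \<Rightarrow> ('a, 'd, 'o) module_scheme \<Rightarrow> ('b \<Rightarrow> 'c) \<Rightarrow> ('c \<Rightarrow> 'd) \<Rightarrow> bool" where
  "short_exact_modules A M N Q f g \<longleftrightarrow>
     module A M \<and> module A N \<and> module A Q \<and>
     f \<in> linear_maps A M N \<and> g \<in> linear_maps A N Q \<and>
     inj_on f (carrier M) \<and>
     f ` carrier M = a_kernel N Q g \<and>
     g ` carrier N = carrier Q"

section \<open>The modules and maps of the sequence\<close>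

text \<open>From here on \<open>B\<close> is the set of representatives of the orbits in \<open>\<XX>\<close>, and \<open>Syl\<close> assigns to
  each pair \<open>x\<close> the chosen Sylow subgroup of \<open>Wgrp G act x\<close>.\<close>

definition Ghost :: "enat \<Rightarrow> ('g set \<times> 'l) set \<Rightarrow> (rat, 'g set \<times> 'l \<Rightarrow> rat) module" where
  "Ghost p B = prod_module B (\<lambda>_. self_module (Zloc p))"

definition Obs_ideal :: "enat \<Rightarrow> ('g set \<times> 'l \<Rightarrow> 'g set set) \<Rightarrow> 'g set \<times> 'l \<Rightarrow> rat set" where
  "Obs_ideal p Syl x = PIdl\<^bsub>Zloc p\<^esub> (of_nat (card (Syl x)))"

definition Obs :: "enat \<Rightarrow> ('g set \<times> 'l \<Rightarrow> 'g set set) \<Rightarrow> ('g set \<times> 'l) set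
    \<Rightarrow> (rat, 'g set \<times> 'l \<Rightarrow> rat set) module" where
  "Obs p Syl B = prod_module B (\<lambda>x. quot_module (Zloc p) (Obs_ideal p Syl x))"

definition mark :: "('g, 'm) monoid_scheme \<Rightarrow> ('g \<Rightarrow> 'l::order \<Rightarrow> 'l)
    \<Rightarrow> 'g set \<times> 'l \<Rightarrow> 'g set \<times> 'l \<Rightarrow> nat" where
  "mark G act = (\<lambda>(U, t) (H, s).
     card {g <#\<^bsub>G\<^esub> H | g. g \<in> carrier G \<and> U \<subseteq> conj_set G g H \<and> t \<le> act g s})"

definition phi :: "('g, 'm) monoid_scheme \<Rightarrow> ('g \<Rightarrow> 'l::order \<Rightarrow> 'l) \<Rightarrow> ('g set \<times> 'l) set
    \<Rightarrow> ('g set \<times> 'l \<Rightarrow>\<^sub>0 rat) \<Rightarrow> 'g set \<times> 'l \<Rightarrow> rat" where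
  "phi G act B f =
     (\<lambda>u\<in>B. \<Sum>b\<in>Poly_Mapping.keys f. Poly_Mapping.lookup f b * of_nat (mark G act u b))"

lemma phi_single: "phi G act B (Poly_Mapping.single b 1) = (\<lambda>u\<in>B. of_nat (mark G act u b))"
  by (auto simp: phi_def restrict_def fun_eq_iff)

text \<open>The component of \<open>x\<close> at an arbitrary pair \<open>u\<close> is its component at the representative of
  the orbit of \<open>u\<close>.\<close>

definition component :: "('g, 'm) monoid_scheme \<Rightarrow> ('g \<Rightarrow> 'l \<Rightarrow> 'l) \<Rightarrow> ('g set \<times> 'l) set
    \<Rightarrow> ('g set \<times> 'l \<Rightarrow> rat) \<Rightarrow> 'g set \<times> 'l \<Rightarrow> rat" where
  "component G act B x u = x (THE r. r \<in> B \<and> r \<in> orbit G (pact G act) u)"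

definition psi :: "enat \<Rightarrow> ('g, 'm) monoid_scheme \<Rightarrow> ('g \<Rightarrow> 'l::{finite,lattice} \<Rightarrow> 'l)
    \<Rightarrow> ('g set \<Rightarrow> 'l set) \<Rightarrow> ('g set \<times> 'l) set \<Rightarrow> ('g set \<times> 'l) set
    \<Rightarrow> ('g set \<times> 'l \<Rightarrow> 'g set set) \<Rightarrow> ('g set \<times> 'l \<Rightarrow> rat) \<Rightarrow> 'g set \<times> 'l \<Rightarrow> rat set" where
  "psi p G act Lf \<XX> B Syl x =
     (\<lambda>u\<in>B. Obs_ideal p Syl u +>\<^bsub>Zloc p\<^esub>
        (\<Sum>C\<in>Syl u. component G act B x (closure_pair G Lf \<XX> (SOME g. g \<in> C) u)))"

end

theory Submission
  imports Defs
begin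

text \<open>
  The sequence is governed by two kinds of information about the table of marks, the matrix with
  entry \<open>mark G act u b\<close> at \<open>u, b \<in> B\<close>.

  First, it is triangular. A nonzero mark exhibits a conjugate of \<open>b\<close> above \<open>u\<close>, so for the
  conjugation invariant grading \<open>psize\<close> either \<open>u = b\<close> or \<open>u\<close> is strictly smaller; and the
  diagonal mark at \<open>u\<close> is the order of \<open>Wgrp G act u\<close>. In particular \<open>phi\<close> is injective.

  Second, its columns satisfy the congruences that define the kernel of \<open>psi\<close>. For \<open>x\<close> in the
  stabilizer of \<open>u\<close>, the cosets counted by the mark at \<open>u\<close> which are fixed by \<open>x\<close> are exactly those
  counted by the mark at the closure of \<open>u\<close> and \<open>x\<close> (\<open>fixed_points_eq_fixpts_closure\<close>). This uses
  the axioms of an admissible family to see that the lattice part of the closure adds no condition,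
  and the fact that a unique minimal element of a finite poset is its least element. Burnside's lemma
  for the Sylow subgroup of \<open>Wgrp G act u\<close> then says that its order divides the sum of these marks.

  Exactness is elementary linear algebra from there (locale \<open>triangular_system\<close>). In the sum that
  defines \<open>psi\<close> at \<open>u\<close>, the trivial coset contributes the component at \<open>u\<close> and all other cosets
  contribute components at strictly larger pairs. So \<open>psi\<close> is surjective by back substitution. For
  an element of its kernel, the top nonzero component, at \<open>u\<close> say, is divisible by the order of the
  Sylow subgroup, hence, the index being a unit, by the diagonal mark. A multiple of the column
  of \<open>u\<close> removes that component without leaving the kernel, and induction shows that the element
  lies in the image of \<open>phi\<close>.

  For the algebra structure it is enough that the image of \<open>phi\<close> is a subring of the ghost ring,
  since an injective map transports the structure back (\<open>algebra_transport\<close>). By exactness this means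
  that the congruences hold for \<open>1\<close>, which is trivial, and for products of two columns, which is
  Burnside's lemma for the product of the two sets of cosets.
\<close>

section \<open>Localized integers\<close>

abbreviation valid_place :: "enat \<Rightarrow> bool" where
  "valid_place p \<equiv> p = \<infinity> \<or> (\<exists>q. p = enat q \<and> normalization_semidom_class.prime q)"

definition denominators :: "enat \<Rightarrow> int set" where
  "denominators p = {b. b \<noteq> 0 \<and> (case p of \<infinity> \<Rightarrow> b = 1 | enat q \<Rightarrow> \<not> int q dvd b)}"

lemma one_in_denominators: "valid_place p \<Longrightarrow> 1 \<in> denominators p"
  by (auto simp: denominators_def dest: prime_gt_1_nat)

lemma mult_in_denominators:
  "valid_place p \<Longrightarrow> a \<in> denominators p \<Longrightarrow> b \<in> denominators p \<Longrightarrow> a * b \<in> denominators p"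
  by (auto simp: denominators_def prime_dvd_mult_iff)

lemma mem_Zloc_iff:
  "x \<in> carrier (Zloc p) \<longleftrightarrow> (\<exists>a. \<exists>b\<in>denominators p. x = of_int a / of_int b)"
  by (auto simp: Zloc_def denominators_def)

lemma Zloc_ops [simp]:
  "x \<otimes>\<^bsub>Zloc p\<^esub> y = x * y" "x \<oplus>\<^bsub>Zloc p\<^esub> y = x + y" "\<one>\<^bsub>Zloc p\<^esub> = 1" "\<zero>\<^bsub>Zloc p\<^esub> = 0"
  by (simp_all add: Zloc_def)

lemma of_int_in_Zloc: "valid_place p \<Longrightarrow> of_int a \<in> carrier (Zloc p)"
  unfolding mem_Zloc_iff using one_in_denominators by (intro exI[of _ a] bexI[of _ 1]) auto

lemma inverse_in_Zloc: "b \<in> denominators p \<Longrightarrow> 1 / of_int b \<in> carrier (Zloc p)"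
  unfolding mem_Zloc_iff by (rule exI[of _ 1]) auto

lemma Zloc_mult_closed:
  assumes "valid_place p" "x \<in> carrier (Zloc p)" "y \<in> carrier (Zloc p)"
  shows "x * y \<in> carrier (Zloc p)"
proof -
  obtain a b c d where "b \<in> denominators p" "d \<in> denominators p"
    "x = of_int a / of_int b" "y = of_int c / of_int d"
    using assms unfolding mem_Zloc_iff by blast
  then show ?thesis
    unfolding mem_Zloc_iff using mult_in_denominators[OF assms(1)]
    by (intro exI[of _ "a * c"] bexI[of _ "b * d"]) auto
qed

lemma Zloc_add_closed:
  assumes "valid_place p" "x \<in> carrier (Zloc p)" "y \<in> carrier (Zloc p)"
  shows "x + y \<in> carrier (Zloc p)"
proof -
  obtain a b c d where bd: "b \<in> denominators p" "d \<in> denominators p"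
    and xy: "x = of_int a / of_int b" "y = of_int c / of_int d"
    using assms unfolding mem_Zloc_iff by blast
  have "b \<noteq> 0" "d \<noteq> 0" using bd by (auto simp: denominators_def)
  then have "x + y = of_int (a * d + c * b) / of_int (b * d)"
    using xy by (simp add: field_simps)
  then show ?thesis
    unfolding mem_Zloc_iff using mult_in_denominators[OF assms(1) bd] by blast
qed

lemma Zloc_minus_closed:
  assumes "valid_place p" "x \<in> carrier (Zloc p)" shows "- x \<in> carrier (Zloc p)"
  using Zloc_mult_closed[OF assms(1) of_int_in_Zloc[OF assms(1), of "-1"] assms(2)] by simp

lemma cring_Zloc:
  assumes "valid_place p" shows "cring (Zloc p)"
proof (rule cringI)
  note closed = Zloc_add_closed[OF assms] Zloc_mult_closed[OF assms] Zloc_minus_closed[OF assms]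
    of_int_in_Zloc[OF assms, of 0] of_int_in_Zloc[OF assms, of 1]
  show "abelian_group (Zloc p)"
  proof (rule abelian_groupI)
    fix x assume "x \<in> carrier (Zloc p)"
    then show "\<exists>y\<in>carrier (Zloc p). y \<oplus>\<^bsub>Zloc p\<^esub> x = \<zero>\<^bsub>Zloc p\<^esub>"
      using closed by (intro bexI[of _ "-x"]) auto
  qed (use closed in auto)
  show "comm_monoid (Zloc p)"
    by (rule comm_monoidI) (use closed in auto)
qed (auto simp: algebra_simps)

section \<open>Products, quotients and transport of algebras\<close>

lemma algebra_self_module:
  assumes "cring A" shows "algebra A (self_module A)"
proof -
  interpret cring A by fact
  have ops: "x \<otimes>\<^bsub>self_module A\<^esub> y = x \<otimes>\<^bsub>A\<^esub> y" "x \<oplus>\<^bsub>self_module A\<^esub> y = x \<oplus>\<^bsub>A\<^esub> y"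
    "\<one>\<^bsub>self_module A\<^esub> = \<one>\<^bsub>A\<^esub>" "\<zero>\<^bsub>self_module A\<^esub> = \<zero>\<^bsub>A\<^esub>" "a \<odot>\<^bsub>self_module A\<^esub> x = a \<otimes>\<^bsub>A\<^esub> x"
    "carrier (self_module A) = carrier A" for x y a
    by (simp_all add: self_module_def)
  have "cring (self_module A)"
  proof (rule cringI)
    show "abelian_group (self_module A)"
      by (rule abelian_groupI) (auto simp: ops a_ac intro: bexI[of _ "\<ominus>\<^bsub>A\<^esub> _"] l_neg)
    show "comm_monoid (self_module A)"
      by (rule comm_monoidI) (auto simp: ops m_ac)
  qed (auto simp: ops l_distr)
  then show ?thesis
    by (intro algebraI assms) (auto simp: ops l_distr r_distr m_assoc)
qed

lemma algebra_quot_module: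
  assumes "cring A" "ideal I A" shows "algebra A (quot_module A I)"
proof -
  interpret A: cring A by fact
  interpret I: ideal I A by fact
  interpret Q: cring "A Quot I" by (rule I.quotient_is_cring[OF assms(1)])
  let ?Q = "quot_module A I"
  note hom = I.rcos_ring_hom
  have ops: "x \<otimes>\<^bsub>?Q\<^esub> y = x \<otimes>\<^bsub>A Quot I\<^esub> y" "x \<oplus>\<^bsub>?Q\<^esub> y = x \<oplus>\<^bsub>A Quot I\<^esub> y"
    "\<one>\<^bsub>?Q\<^esub> = \<one>\<^bsub>A Quot I\<^esub>" "\<zero>\<^bsub>?Q\<^esub> = \<zero>\<^bsub>A Quot I\<^esub>"
    "a \<odot>\<^bsub>?Q\<^esub> x = (I +>\<^bsub>A\<^esub> a) \<otimes>\<^bsub>A Quot I\<^esub> x" "carrier ?Q = carrier (A Quot I)" for x y a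
    by (simp_all add: quot_module_def)
  have "cring ?Q"
  proof (rule cringI)
    show "abelian_group ?Q"
      by (rule abelian_groupI)
        (auto simp: ops Q.a_ac intro: bexI[of _ "\<ominus>\<^bsub>A Quot I\<^esub> _"] Q.l_neg)
    show "comm_monoid ?Q"
      by (rule comm_monoidI) (auto simp: ops Q.m_ac)
  qed (auto simp: ops Q.l_distr)
  then show ?thesis
    by (intro algebraI assms)
      (auto simp: ops Q.l_distr Q.r_distr Q.m_assoc ring_hom_closed[OF hom] ring_hom_add[OF hom]
        ring_hom_mult[OF hom] ring_hom_one[OF hom])
qed

lemma algebra_prod_module:
  assumes "cring A" and M: "\<And>i. i \<in> I \<Longrightarrow> algebra A (M i)"
  shows "algebra A (prod_module I M)"
proof -
  let ?P = "prod_module I M"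
  have cr: "cring (M i)" if "i \<in> I" for i using M[OF that] by (rule algebra.M_cring)
  have md: "module A (M i)" if "i \<in> I" for i using M[OF that] by (rule algebra.module)
  have ri: "ring (M i)" if "i \<in> I" for i using cr[OF that] by (rule cring.axioms)
  have ops: "x \<otimes>\<^bsub>?P\<^esub> y = (\<lambda>i\<in>I. x i \<otimes>\<^bsub>M i\<^esub> y i)" "x \<oplus>\<^bsub>?P\<^esub> y = (\<lambda>i\<in>I. x i \<oplus>\<^bsub>M i\<^esub> y i)"
    "\<one>\<^bsub>?P\<^esub> = (\<lambda>i\<in>I. \<one>\<^bsub>M i\<^esub>)" "\<zero>\<^bsub>?P\<^esub> = (\<lambda>i\<in>I. \<zero>\<^bsub>M i\<^esub>)"
    "a \<odot>\<^bsub>?P\<^esub> x = (\<lambda>i\<in>I. a \<odot>\<^bsub>M i\<^esub> x i)" "carrier ?P = (\<Pi>\<^sub>E i\<in>I. carrier (M i))" for x y a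
    by (simp_all add: prod_module_def)
  have eq: "x = y" if "x \<in> (\<Pi>\<^sub>E i\<in>I. carrier (M i))" "y \<in> (\<Pi>\<^sub>E i\<in>I. carrier (M i))"
    "\<And>i. i \<in> I \<Longrightarrow> x i = y i" for x y
    using that by (intro PiE_ext)
  note [simp] = ring.ring_simprules[OF ri]
  note comm [simp] = cring.cring_simprules[OF cr]
  note [simp] = monoid.r_one[OF ring.is_monoid[OF ri]] module.smult_closed[OF md]
  have "cring ?P"
  proof (rule cringI)
    show "abelian_group ?P"
    proof (rule abelian_groupI)
      fix x assume x: "x \<in> carrier ?P"
      have "(\<lambda>i\<in>I. \<ominus>\<^bsub>M i\<^esub> x i) \<in> carrier ?P" using x by (auto simp: ops PiE_def Pi_def)
      moreover have "(\<lambda>i\<in>I. \<ominus>\<^bsub>M i\<^esub> x i) \<oplus>\<^bsub>?P\<^esub> x = \<zero>\<^bsub>?P\<^esub>"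
        using x by (auto simp: ops PiE_def Pi_def fun_eq_iff)
      ultimately show "\<exists>y\<in>carrier ?P. y \<oplus>\<^bsub>?P\<^esub> x = \<zero>\<^bsub>?P\<^esub>" by blast
    qed (auto simp: ops intro!: eq; simp add: PiE_def Pi_def)+
    show "comm_monoid ?P"
      by (rule comm_monoidI) (auto simp: ops intro!: eq; simp add: PiE_def Pi_def)+
  qed (auto simp: ops intro!: eq; simp add: PiE_def Pi_def)
  \<comment> \<open>Commutativity as a rewrite rule would reorder the products in \<open>smult_assoc2\<close>.\<close>
  note [simp del] = comm
  note [simp] = ring.ring_simprules[OF ri]
  show ?thesis
    by (intro algebraI assms \<open>cring ?P\<close>)
      (auto simp: ops intro!: eq; simp add: PiE_def Pi_def module.smult_l_distr[OF md]
        module.smult_r_distr[OF md] module.smult_assoc1[OF md] module.smult_one[OF md]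
        algebra.smult_assoc2[OF M])+
qed

lemma lookup_map_mult:
  "Poly_Mapping.lookup (Poly_Mapping.map (\<lambda>c. a * c) f) b = (a::rat) * Poly_Mapping.lookup f b"
  by (simp add: Poly_Mapping.map.rep_eq when_def)

lemma module_free_module:
  assumes p: "valid_place p" shows "module (Zloc p) (free_module p B)"
proof -
  let ?F = "free_module p B"
  note closed = Zloc_add_closed[OF p] Zloc_mult_closed[OF p] Zloc_minus_closed[OF p]
    of_int_in_Zloc[OF p, of 0]
  have ops: "x \<oplus>\<^bsub>?F\<^esub> y = x + y" "\<zero>\<^bsub>?F\<^esub> = 0"
    "a \<odot>\<^bsub>?F\<^esub> x = Poly_Mapping.map (\<lambda>c. a * c) x" for x y a
    by (simp_all add: free_module_def)
  have mem: "x \<in> carrier ?F \<longleftrightarrow> (\<forall>b. Poly_Mapping.lookup x b \<in> carrier (Zloc p)) \<and>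
      (\<forall>b. b \<notin> B \<longrightarrow> Poly_Mapping.lookup x b = 0)" for x
    by (auto simp: free_module_def in_keys_iff)
  have "abelian_group ?F"
  proof (rule abelian_groupI)
    fix x assume "x \<in> carrier ?F"
    then show "\<exists>y\<in>carrier ?F. y \<oplus>\<^bsub>?F\<^esub> x = \<zero>\<^bsub>?F\<^esub>"
      using closed by (intro bexI[of _ "-x"]) (auto simp: mem ops)
  qed (use closed in \<open>auto simp: mem ops lookup_add\<close>)
  then show ?thesis
    by (intro moduleI cring_Zloc[OF p])
      (auto simp: ops mem lookup_map_mult lookup_add closed distrib_left distrib_right mult.assoc
        lookup_map_mult[of 1, simplified] lookup_map_mult[of "_ * _", simplified mult.assoc]
        lookup_map_mult[of "_ + _", simplified distrib_right] intro!: poly_mapping_eqI)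
qed

text \<open>Multiplying inside the image of an injective linear map is the only way to make that map a
  homomorphism; the ring axioms are then inherited from the target.\<close>

lemma algebra_transport:
  fixes M :: "('a, 'b, 'm) module_scheme" and N :: "('a, 'c, 'n) module_scheme"
  assumes M: "module A M" and N: "algebra A N"
    and lin: "f \<in> linear_maps A M N" and inj: "inj_on f (carrier M)"
    and one: "\<one>\<^bsub>N\<^esub> \<in> f ` carrier M"
    and mult: "\<And>x y. x \<in> carrier M \<Longrightarrow> y \<in> carrier M \<Longrightarrow> f x \<otimes>\<^bsub>N\<^esub> f y \<in> f ` carrier M"
  obtains m e where "algebra A (M\<lparr>monoid.mult := m, one := e\<rparr>)"
    "f \<in> ring_hom (M\<lparr>monoid.mult := m, one := e\<rparr>) N"
    "f \<in> linear_maps A (M\<lparr>monoid.mult := m, one := e\<rparr>) N"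
proof -
  interpret M: module A M by fact
  interpret N: algebra A N by fact
  define m where "m = (\<lambda>x y. inv_into (carrier M) f (f x \<otimes>\<^bsub>N\<^esub> f y))"
  define e where "e = inv_into (carrier M) f \<one>\<^bsub>N\<^esub>"
  let ?M = "M\<lparr>monoid.mult := m, one := e\<rparr>"
  have f_closed: "f x \<in> carrier N" if "x \<in> carrier M" for x
    using lin that by (auto simp: linear_maps_def)
  have f_add: "f (x \<oplus>\<^bsub>M\<^esub> y) = f x \<oplus>\<^bsub>N\<^esub> f y" if "x \<in> carrier M" "y \<in> carrier M" for x y
    using lin that by (auto simp: linear_maps_def)
  have f_smult: "f (a \<odot>\<^bsub>M\<^esub> x) = a \<odot>\<^bsub>N\<^esub> f x" if "a \<in> carrier A" "x \<in> carrier M" for a x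
    using lin that by (auto simp: linear_maps_def)
  have m_closed: "m x y \<in> carrier M" if "x \<in> carrier M" "y \<in> carrier M" for x y
    unfolding m_def by (rule inv_into_into[OF mult[OF that]])
  have e_closed: "e \<in> carrier M" unfolding e_def by (rule inv_into_into[OF one])
  have f_m: "f (m x y) = f x \<otimes>\<^bsub>N\<^esub> f y" if "x \<in> carrier M" "y \<in> carrier M" for x y
    unfolding m_def by (rule f_inv_into_f[OF mult[OF that]])
  have f_e: "f e = \<one>\<^bsub>N\<^esub>" unfolding e_def by (rule f_inv_into_f[OF one])
  note closed = f_closed m_closed e_closed
  note hom = f_add f_smult f_m f_e
  have eq: "x = y" if "x \<in> carrier M" "y \<in> carrier M" "f x = f y" for x y
    using inj that by (auto dest: inj_onD)
  have ops: "x \<otimes>\<^bsub>?M\<^esub> y = m x y" "x \<oplus>\<^bsub>?M\<^esub> y = x \<oplus>\<^bsub>M\<^esub> y" "\<one>\<^bsub>?M\<^esub> = e" "\<zero>\<^bsub>?M\<^esub> = \<zero>\<^bsub>M\<^esub>"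
    "a \<odot>\<^bsub>?M\<^esub> x = a \<odot>\<^bsub>M\<^esub> x" "carrier ?M = carrier M" for x y a
    by simp_all
  have "cring ?M"
  proof (rule cringI)
    show "abelian_group ?M"
      by (rule abelian_groupI)
        (auto simp: M.a_ac intro: bexI[of _ "\<ominus>\<^bsub>M\<^esub> _"] M.M.l_neg)
    show "comm_monoid ?M"
      by (rule comm_monoidI)
        (auto simp: closed hom N.m_ac intro!: eq)
  qed (auto simp: closed hom N.l_distr intro!: eq)
  then have "algebra A ?M"
    by (intro algebraI M.R.cring_axioms)
      (auto simp: closed hom M.smult_l_distr M.smult_r_distr M.smult_assoc1 N.smult_assoc2 intro!: eq)
  moreover have "f \<in> ring_hom ?M N" by (rule ring_hom_memI) (auto simp: closed hom)
  moreover have "f \<in> linear_maps A ?M N" using lin by (simp add: linear_maps_def)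
  ultimately show ?thesis by (rule that)
qed

section \<open>Integrality for triangular systems\<close>

text \<open>The combinatorial content of the exact sequence, without groups. The matrix \<open>M\<close> plays the
  role of the table of marks: by \<open>M_upper\<close> it is triangular for the grading \<open>m\<close>. The congruence at
  \<open>u\<close> says that \<open>n u\<close> divides the sum of the entries at the positions \<open>r u c\<close> for \<open>c \<in> S u\<close>; the
  index \<open>e u\<close> returns \<open>u\<close> itself and all others lead strictly up in the grading, so the sums form
  a unitriangular system. The assumption \<open>n_diag\<close> says that \<open>M u u\<close> divides \<open>n u\<close>
  in \<open>A\<close>; it is what makes the congruences sufficient for being in the image of \<open>M\<close>.\<close>

locale triangular_system =
  fixes A :: "rat set" and B :: "'i set" and M :: "'i \<Rightarrow> 'i \<Rightarrow> rat"
    and S :: "'i \<Rightarrow> 'c set" and r :: "'i \<Rightarrow> 'c \<Rightarrow> 'i" and e :: "'i \<Rightarrow> 'c"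
    and n :: "'i \<Rightarrow> rat" and m :: "'i \<Rightarrow> nat"
  assumes finite_B: "finite B" and finite_S: "u \<in> B \<Longrightarrow> finite (S u)"
    and zero_A: "0 \<in> A" and add_A: "x \<in> A \<Longrightarrow> y \<in> A \<Longrightarrow> x + y \<in> A"
    and minus_A: "x \<in> A \<Longrightarrow> - x \<in> A" and mult_A: "x \<in> A \<Longrightarrow> y \<in> A \<Longrightarrow> x * y \<in> A"
    and M_in_A: "u \<in> B \<Longrightarrow> b \<in> B \<Longrightarrow> M u b \<in> A"
    and M_upper: "u \<in> B \<Longrightarrow> b \<in> B \<Longrightarrow> M u b \<noteq> 0 \<Longrightarrow> u = b \<or> m u < m b"
    and M_diag: "u \<in> B \<Longrightarrow> M u u \<noteq> 0"
    and n_diag: "u \<in> B \<Longrightarrow> n u / M u u \<in> A"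
    and e_in_S: "u \<in> B \<Longrightarrow> e u \<in> S u" and r_e: "u \<in> B \<Longrightarrow> r u (e u) = u"
    and r_in_B: "u \<in> B \<Longrightarrow> c \<in> S u \<Longrightarrow> r u c \<in> B"
    and r_upper: "u \<in> B \<Longrightarrow> c \<in> S u \<Longrightarrow> c \<noteq> e u \<Longrightarrow> m u < m (r u c)"
begin

definition congruent :: "('i \<Rightarrow> rat) \<Rightarrow> bool" where
  "congruent y \<longleftrightarrow> (\<forall>u\<in>B. \<exists>a\<in>A. (\<Sum>c\<in>S u. y (r u c)) = a * n u)"

lemma sum_in_A: "(\<And>i. i \<in> I \<Longrightarrow> f i \<in> A) \<Longrightarrow> sum f I \<in> A"
  by (induction I rule: infinite_finite_induct) (auto intro: zero_A add_A)

lemma congruent_add: "congruent x \<Longrightarrow> congruent y \<Longrightarrow> congruent (\<lambda>u. x u + y u)"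
  unfolding congruent_def by (auto simp: sum.distrib) (metis add_A distrib_right)

lemma congruent_cmult: "a \<in> A \<Longrightarrow> congruent x \<Longrightarrow> congruent (\<lambda>u. a * x u)"
  unfolding congruent_def by (auto simp flip: sum_distrib_left) (metis mult_A mult.assoc)

lemma congruent_sum: "(\<And>i. i \<in> I \<Longrightarrow> congruent (f i)) \<Longrightarrow> congruent (\<lambda>u. \<Sum>i\<in>I. f i u)"
proof (induction I rule: infinite_finite_induct)
  case (insert i I)
  then have "congruent (\<lambda>u. f i u + (\<Sum>i\<in>I. f i u))" by (intro congruent_add) auto
  with insert show ?case by simp
qed (auto simp: congruent_def intro!: bexI[OF _ zero_A])

lemma congruent_cong: "(\<And>u. u \<in> B \<Longrightarrow> x u = y u) \<Longrightarrow> congruent x \<Longrightarrow> congruent y"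
  unfolding congruent_def using r_in_B by simp

text \<open>Columns belonging to positions that are not above \<open>u\<close> have entry \<open>0\<close> in row \<open>u\<close>, except for the
  column of \<open>u\<close>. Hence the top nonzero entry of \<open>x\<close> is only multiplied by a diagonal entry, which
  gives injectivity below.\<close>

lemma apply_matrix_top:
  assumes "u \<in> B" "\<And>b. b \<in> B \<Longrightarrow> m u < m b \<Longrightarrow> x b = 0"
  shows "(\<Sum>b\<in>B. x b * M u b) = x u * M u u"
proof -
  have "(\<Sum>b\<in>B. x b * M u b) = (\<Sum>b\<in>B. if b = u then x b * M u b else 0)"
    using assms M_upper by (intro sum.cong) auto
  then show ?thesis using assms finite_B by simp
qed

lemma matrix_injective:
  assumes "\<And>u. u \<in> B \<Longrightarrow> (\<Sum>b\<in>B. x b * M u b) = 0" and "u \<in> B"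
  shows "x u = 0"
proof -
  have "\<forall>u\<in>B. k \<le> m u \<longrightarrow> x u = 0" for k
  proof -
    obtain K where K: "\<forall>u\<in>B. m u < K" using finite_nat_set_iff_bounded[of "m ` B"] finite_B by auto
    show ?thesis
    proof (induction "K - k" arbitrary: k)
      case 0 then show ?case using K by force
    next
      case (Suc d)
      have "d = K - Suc k" using Suc.hyps(2) by simp
      then have IH: "\<forall>u\<in>B. Suc k \<le> m u \<longrightarrow> x u = 0" by (rule Suc.hyps(1))
      have "x u = 0" if "u \<in> B" "m u = k" for u
      proof -
        have "(\<Sum>b\<in>B. x b * M u b) = x u * M u u"
          using IH that by (intro apply_matrix_top) auto
        then show ?thesis using that assms(1) M_diag by simp
      qed
      then show ?case using IH by (metis Suc_leI le_neq_implies_less)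
    qed
  qed
  then show ?thesis using assms(2) by blast
qed

lemma sum_r_top:
  assumes "u \<in> B"
  shows "(\<Sum>c\<in>S u. y (r u c)) = y u + (\<Sum>c\<in>S u - {e u}. y (r u c))"
  using assms by (simp add: sum.remove[OF finite_S e_in_S] r_e)

text \<open>Back substitution along decreasing \<open>m\<close>: in the sum at \<open>u\<close> the entry \<open>y u\<close> has coefficient \<open>1\<close>,
  and all other entries are at positions treated before.\<close>

lemma congruence_operator_surj:
  assumes z: "\<And>u. u \<in> B \<Longrightarrow> z u \<in> A"
  obtains y where "\<And>u. u \<in> B \<Longrightarrow> y u \<in> A" "\<And>u. u \<in> B \<Longrightarrow> (\<Sum>c\<in>S u. y (r u c)) = z u"
proof -
  have "\<exists>y. (\<forall>u\<in>B. y u \<in> A) \<and> (\<forall>u\<in>B. k \<le> m u \<longrightarrow> (\<Sum>c\<in>S u. y (r u c)) = z u)" for k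
  proof -
    obtain K where K: "\<forall>u\<in>B. m u < K" using finite_nat_set_iff_bounded[of "m ` B"] finite_B by auto
    show ?thesis
    proof (induction "K - k" arbitrary: k)
      case 0 then show ?case using K zero_A by (intro exI[of _ "\<lambda>_. 0"]) force
    next
      case (Suc d)
      then obtain y where y: "\<forall>u\<in>B. y u \<in> A"
        "\<forall>u\<in>B. Suc k \<le> m u \<longrightarrow> (\<Sum>c\<in>S u. y (r u c)) = z u"
        by (metis Suc_inject Suc_diff_Suc diff_is_0_eq nat.distinct(1) not_less)
      \<comment> \<open>The summands other than \<open>y u\<close> lie above level \<open>k\<close>, where \<open>y\<close> is final.\<close>
      define y' where "y' = (\<lambda>u. if m u = k then z u - (\<Sum>c\<in>S u - {e u}. y (r u c)) else y u)"
      have above: "y' v = y v" if "k < m v" for v using that by (simp add: y'_def)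
      have "y' u \<in> A" if u: "u \<in> B" for u
      proof -
        have "(\<Sum>c\<in>S u - {e u}. y (r u c)) \<in> A" using u y(1) r_in_B by (intro sum_in_A) auto
        then show ?thesis using u y(1) add_A[OF z minus_A] by (auto simp: y'_def)
      qed
      moreover have "(\<Sum>c\<in>S u. y' (r u c)) = z u" if u: "u \<in> B" "k \<le> m u" for u
      proof -
        have "(\<Sum>c\<in>S u - {e u}. y' (r u c)) = (\<Sum>c\<in>S u - {e u}. y (r u c))"
          using u r_upper by (intro sum.cong refl above) fastforce
        then show ?thesis
          using u y(2) sum_r_top[OF u(1), of y'] sum_r_top[OF u(1), of y] above[of u]
          by (cases "m u = k") (auto simp: y'_def)
      qed
      ultimately show ?case by blast
    qed
  qed
  from this[of 0] show ?thesis using that by auto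
qed

text \<open>A congruent vector is peeled from the top. At a position \<open>u\<close> above which it vanishes, its
  congruence degenerates to \<open>n u dvd y u\<close>, and \<open>n u\<close> is a multiple of the diagonal entry
  \<open>M u u\<close>; so a multiple of the column of \<open>u\<close> removes the entry, and the difference is again
  congruent because columns are.\<close>

lemma congruent_imp_in_image:
  assumes cols: "\<And>b. b \<in> B \<Longrightarrow> congruent (\<lambda>u. M u b)"
    and y: "congruent y" "\<And>u. u \<in> B \<Longrightarrow> y u \<in> A"
  obtains x where "\<And>b. b \<in> B \<Longrightarrow> x b \<in> A" "\<And>u. u \<in> B \<Longrightarrow> y u = (\<Sum>b\<in>B. x b * M u b)"
proof -
  have "\<exists>x. (\<forall>b\<in>B. x b \<in> A) \<and> (\<forall>u\<in>B. y u = (\<Sum>b\<in>B. x b * M u b))"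
    if "congruent y" "\<forall>u\<in>B. y u \<in> A" "\<forall>u\<in>B. k \<le> m u \<longrightarrow> y u = 0" for k y
    using that
  proof (induction k arbitrary: y)
    case 0
    then show ?case using zero_A by (intro exI[of _ "\<lambda>_. 0"]) auto
  next
    case (Suc k)
    have "\<exists>x\<in>A. y u = x * M u u" if u: "u \<in> B" "m u = k" for u
    proof -
      have "(\<Sum>c\<in>S u - {e u}. y (r u c)) = 0"
      proof (intro sum.neutral ballI)
        fix c assume "c \<in> S u - {e u}"
        then show "y (r u c) = 0"
          using u r_upper[OF u(1), of c] r_in_B[OF u(1), of c] Suc.prems(3) by auto
      qed
      then obtain a where "a \<in> A" "y u = a * n u"
        using Suc.prems(1) u sum_r_top[OF u(1), of y] by (auto simp: congruent_def)
      then show ?thesis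
        using u M_diag mult_A[OF _ n_diag] by (intro bexI[of _ "a * (n u / M u u)"]) auto
    qed
    then obtain x1 where x1: "\<And>u. u \<in> B \<Longrightarrow> m u = k \<Longrightarrow> x1 u \<in> A \<and> y u = x1 u * M u u"
      by metis
    define x0 where "x0 = (\<lambda>u. if m u = k then x1 u else 0)"
    have x0: "x0 u \<in> A" if "u \<in> B" for u using that x1 zero_A by (auto simp: x0_def)
    define y' where "y' = (\<lambda>u. y u + (- 1) * (\<Sum>b\<in>B. x0 b * M u b))"
    have "congruent (\<lambda>u. \<Sum>b\<in>B. x0 b * M u b)"
      using x0 cols by (intro congruent_sum congruent_cmult)
    then have "congruent (\<lambda>u. (- 1) * (\<Sum>b\<in>B. x0 b * M u b))"
      unfolding congruent_def
      by (auto simp: sum_negf) (metis minus_A mult_minus_left)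
    then have "congruent y'" unfolding y'_def by (intro congruent_add Suc.prems)
    moreover have "\<forall>u\<in>B. y' u \<in> A"
      using Suc.prems x0 by (auto simp: y'_def intro!: minus_A add_A sum_in_A mult_A M_in_A
        simp del: add_uminus_conv_diff)
    moreover have "y' u = 0" if u: "u \<in> B" "k \<le> m u" for u
    proof -
      have "(\<Sum>b\<in>B. x0 b * M u b) = x0 u * M u u"
        using u by (intro apply_matrix_top) (auto simp: x0_def)
      then show ?thesis
        using u x1[of u] Suc.prems(3) by (cases "m u = k") (auto simp: y'_def x0_def)
    qed
    ultimately obtain x' where x': "\<forall>b\<in>B. x' b \<in> A" "\<forall>u\<in>B. y' u = (\<Sum>b\<in>B. x' b * M u b)"
      using Suc.IH[of y'] by blast
    show ?case
    proof (intro exI[of _ "\<lambda>b. x' b + x0 b"] conjI ballI)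
      fix u assume "u \<in> B"
      then have "y' u = (\<Sum>b\<in>B. x' b * M u b)" using x'(2) by blast
      then show "y u = (\<Sum>b\<in>B. (x' b + x0 b) * M u b)"
        by (simp add: y'_def distrib_right sum.distrib)
    qed (use x' x0 add_A in auto)
  qed
  note peel = this
  obtain K where "\<forall>u\<in>B. m u < K"
    using finite_nat_set_iff_bounded[of "m ` B"] finite_B by auto
  then have "\<forall>u\<in>B. K \<le> m u \<longrightarrow> y u = 0" by force
  then obtain x where "\<forall>b\<in>B. x b \<in> A" "\<forall>u\<in>B. y u = (\<Sum>b\<in>B. x b * M u b)"
    using peel[of y K] y by blast
  then show ?thesis using that by auto
qed

end

section \<open>Burnside's lemma\<close>

text \<open>The quotient is the number of orbits. Divisibility is all that the congruences need, so the action
  is given by a plain function satisfying the action laws on \<open>E\<close>.\<close>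

lemma order_dvd_sum_card_fixed_points:
  assumes W: "group W" and fin: "finite (carrier W)" "finite E"
    and closed: "\<And>g x. g \<in> carrier W \<Longrightarrow> x \<in> E \<Longrightarrow> a g x \<in> E"
    and one: "\<And>x. x \<in> E \<Longrightarrow> a \<one>\<^bsub>W\<^esub> x = x"
    and mult: "\<And>g h x. g \<in> carrier W \<Longrightarrow> h \<in> carrier W \<Longrightarrow> x \<in> E \<Longrightarrow> a (g \<otimes>\<^bsub>W\<^esub> h) x = a g (a h x)"
  shows "order W dvd (\<Sum>g\<in>carrier W. card {x \<in> E. a g x = x})"
proof -
  interpret W: group W by fact
  let ?a = "\<lambda>g. \<lambda>x\<in>E. a g x"
  have bij: "bij_betw (a g) E E" if g: "g \<in> carrier W" for g
  proof (rule bij_betwI[of _ _ _ "a (inv\<^bsub>W\<^esub> g)"])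
    show "a g \<in> E \<rightarrow> E" "a (inv\<^bsub>W\<^esub> g) \<in> E \<rightarrow> E" using g closed by auto
  next
    fix x assume "x \<in> E"
    then show "a (inv\<^bsub>W\<^esub> g) (a g x) = x" "a g (a (inv\<^bsub>W\<^esub> g) x) = x"
      using g one mult[of "inv\<^bsub>W\<^esub> g" g x] mult[of g "inv\<^bsub>W\<^esub> g" x] by auto
  qed
  have "group_hom W (BijGroup E) ?a"
  proof (intro group_hom.intro group_hom_axioms.intro W group_BijGroup homI)
    fix g assume "g \<in> carrier W"
    then show "?a g \<in> carrier (BijGroup E)"
      using bij by (auto simp: BijGroup_def Bij_def cong: bij_betw_cong)
  next
    fix g h assume gh: "g \<in> carrier W" "h \<in> carrier W"
    then have "?a g \<in> Bij E" "?a h \<in> Bij E" using bij by (auto simp: Bij_def cong: bij_betw_cong)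
    then show "?a (g \<otimes>\<^bsub>W\<^esub> h) = ?a g \<otimes>\<^bsub>BijGroup E\<^esub> ?a h"
      using gh mult closed by (auto simp: BijGroup_def compose_def fun_eq_iff)
  qed
  then have "group_action W E ?a" by (rule group_action.intro)
  from group_action.burnside[OF this fin]
  have "order W dvd (\<Sum>g\<in>carrier W. card (invariants E ?a g))" by (metis dvd_triv_right)
  moreover have "invariants E ?a g = {x \<in> E. a g x = x}" for g by (auto simp: invariants_def)
  ultimately show ?thesis by simp
qed

section \<open>Pairs and their stabilizers\<close>

context admissible_family
begin

lemma act_mult: "g \<in> carrier G \<Longrightarrow> h \<in> carrier G \<Longrightarrow> act (g \<otimes> h) s = act g (act h s)"
  using composition_rule[of s g h] by simp

lemma act_one: "act \<one> s = s"
  using id_eq_one by (metis UNIV_I restrict_apply')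

lemma act_le: "g \<in> carrier G \<Longrightarrow> s \<le> t \<Longrightarrow> act g s \<le> act g t"
  using act_mono by (auto dest: monoD)

lemma G_group: "group G"
  using group_hom group_hom.axioms(1) by blast

sublocale group G by (rule G_group)

lemma mult_inv_cancel:
  "g \<in> carrier G \<Longrightarrow> x \<in> carrier G \<Longrightarrow> g \<otimes> (inv g \<otimes> x) = x"
  "g \<in> carrier G \<Longrightarrow> x \<in> carrier G \<Longrightarrow> inv g \<otimes> (g \<otimes> x) = x"
  by (simp_all add: m_assoc[symmetric])

lemma act_inv: "g \<in> carrier G \<Longrightarrow> act (inv g) (act g s) = s" "g \<in> carrier G \<Longrightarrow> act g (act (inv g) s) = s"
  by (simp_all add: act_mult[symmetric] act_one)

lemma mem_conj_set:
  assumes "g \<in> carrier G" "H \<subseteq> carrier G"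
  shows "x \<in> conj_set G g H \<longleftrightarrow> x \<in> carrier G \<and> inv g \<otimes> x \<otimes> g \<in> H"
proof
  assume "x \<in> conj_set G g H"
  then obtain h where h: "h \<in> H" "x = g \<otimes> h \<otimes> inv g" by (auto simp: r_coset_def l_coset_def)
  then have "h \<in> carrier G" using assms by auto
  moreover from this have "inv g \<otimes> x \<otimes> g = h"
    using h assms by (simp add: m_assoc mult_inv_cancel)
  ultimately show "x \<in> carrier G \<and> inv g \<otimes> x \<otimes> g \<in> H" using h assms by auto
next
  assume x: "x \<in> carrier G \<and> inv g \<otimes> x \<otimes> g \<in> H"
  then have "g \<otimes> (inv g \<otimes> x \<otimes> g) \<otimes> inv g = x"
    using assms by (simp add: m_assoc mult_inv_cancel)
  moreover have "g \<otimes> (inv g \<otimes> x \<otimes> g) \<otimes> inv g \<in> conj_set G g H"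
    using x by (auto simp: r_coset_def l_coset_def)
  ultimately show "x \<in> conj_set G g H" by simp
qed

lemma conj_set_one: "H \<subseteq> carrier G \<Longrightarrow> conj_set G \<one> H = H"
  by (simp add: lcos_mult_one)

lemma conj_set_mult:
  assumes "g \<in> carrier G" "h \<in> carrier G" "H \<subseteq> carrier G"
  shows "conj_set G (g \<otimes> h) H = conj_set G g (conj_set G h H)"
proof -
  have sub: "conj_set G h H \<subseteq> carrier G" using mem_conj_set[OF assms(2,3)] by auto
  show ?thesis
  proof (rule Set.set_eqI)
    fix x
    show "x \<in> conj_set G (g \<otimes> h) H \<longleftrightarrow> x \<in> conj_set G g (conj_set G h H)"
      unfolding mem_conj_set[OF m_closed[OF assms(1,2)] assms(3)] mem_conj_set[OF assms(1) sub]
        mem_conj_set[OF assms(2,3)]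
      using assms by (auto simp: m_assoc inv_mult_group)
  qed
qed

lemma conj_set_mono: "H \<subseteq> K \<Longrightarrow> conj_set G g H \<subseteq> conj_set G g K"
  by (auto simp: r_coset_def l_coset_def)

lemma subgroup_conj_set:
  assumes "g \<in> carrier G" "subgroup H G" shows "subgroup (conj_set G g H) G"
  using subgroup_conjugation_is_surj2 assms by blast

lemma pairsD:
  assumes "x \<in> pairs G Lf"
  shows "subgroup (fst x) G" "fst x \<subseteq> carrier G" "snd x \<in> Lf (fst x)" "finite (fst x)"
  using assms finite_carrier
  by (auto simp: pairs_def dest: subgroup.mem_carrier intro: finite_subset[OF subgroup.subset])

lemma pact_alt: "pact G act g x = (conj_set G g (fst x), act g (snd x))"
  by (simp add: pact_def case_prod_beta)

lemma pact_in_pairs: "g \<in> carrier G \<Longrightarrow> x \<in> pairs G Lf \<Longrightarrow> pact G act g x \<in> pairs G Lf"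
  using conj[of "fst x" g] subgroup_conj_set[of g "fst x"] by (auto simp: pairs_def pact_def)

lemma pact_one: "x \<in> pairs G Lf \<Longrightarrow> pact G act \<one> x = x"
  using conj_set_one[OF pairsD(2)] by (simp add: pact_alt act_one)

lemma pact_mult:
  "g \<in> carrier G \<Longrightarrow> h \<in> carrier G \<Longrightarrow> x \<in> pairs G Lf \<Longrightarrow>
    pact G act (g \<otimes> h) x = pact G act g (pact G act h x)"
  using conj_set_mult[OF _ _ pairsD(2)] by (simp add: pact_alt act_mult)

lemma pact_inv:
  "g \<in> carrier G \<Longrightarrow> x \<in> pairs G Lf \<Longrightarrow> pact G act (inv g) (pact G act g x) = x"
  by (simp add: pact_mult[symmetric] pact_one)

lemma pair_le_alt: "pair_le x y \<longleftrightarrow> fst x \<subseteq> fst y \<and> snd x \<le> snd y"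
  by (simp add: pair_le_def case_prod_beta)

lemma pair_le_trans: "pair_le x y \<Longrightarrow> pair_le y z \<Longrightarrow> pair_le x z"
  by (auto simp: pair_le_alt)

lemma pact_pair_le:
  assumes "g \<in> carrier G" "pair_le x y"
  shows "pair_le (pact G act g x) (pact G act g y)"
  using assms conj_set_mono act_le
  by (auto simp: pair_le_alt pact_alt)

text \<open>A grading of the pairs that is constant on orbits and strictly increasing for \<open>pair_le\<close>. Comparing
  only the subgroups is not enough: a mark of \<open>(U, t)\<close> on \<open>(U, s)\<close> with \<open>t < s\<close> can be nonzero.\<close>

definition psize :: "'g set \<times> 'l \<Rightarrow> nat" where
  "psize x = card (fst x) + card {l. l \<le> snd x}"

lemma psize_less:
  assumes "pair_le x y" "finite (fst y)" "x \<noteq> y"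
  shows "psize x < psize y"
proof -
  have sub: "fst x \<subseteq> fst y" "{l. l \<le> snd x} \<subseteq> {l. l \<le> snd y}"
    using assms(1) by (auto simp: pair_le_alt intro: order_trans)
  then have le: "card (fst x) \<le> card (fst y)" "card {l. l \<le> snd x} \<le> card {l. l \<le> snd y}"
    using assms(2) by (auto intro: card_mono)
  show ?thesis
  proof (cases "fst x = fst y")
    case False
    then have "card (fst x) < card (fst y)" using sub assms(2) by (intro psubset_card_mono) auto
    then show ?thesis using le by (simp add: psize_def)
  next
    case True
    then have "snd x < snd y" using assms by (auto simp: pair_le_alt prod_eq_iff)
    then have "{l. l \<le> snd x} \<subset> {l. l \<le> snd y}" using sub(2) by (auto simp: less_le_not_le)
    then have "card {l. l \<le> snd x} < card {l. l \<le> snd y}" by (intro psubset_card_mono) auto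
    then show ?thesis using le by (simp add: psize_def)
  qed
qed

text \<open>Conjugation by \<open>g\<close> is injective, and \<open>act g\<close> is an order automorphism, so it maps the elements
  below \<open>s\<close> bijectively to those below \<open>act g s\<close>.\<close>

lemma psize_pact:
  assumes g: "g \<in> carrier G" and x: "x \<in> pairs G Lf"
  shows "psize (pact G act g x) = psize x"
proof -
  have "bij_betw (\<lambda>y. g \<otimes> y \<otimes> inv g) (fst x) (conj_set G g (fst x))"
  proof (rule bij_betw_imageI)
    show "inj_on (\<lambda>y. g \<otimes> y \<otimes> inv g) (fst x)"
      using g pairsD(2)[OF x] by (intro inj_onI) (simp add: subsetD)
  qed (auto simp: r_coset_def l_coset_def)
  moreover have "bij_betw (act g) {l. l \<le> snd x} {l. l \<le> act g (snd x)}"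
  proof (rule bij_betwI[of _ _ _ "act (inv g)"])
    show "act (inv g) \<in> {l. l \<le> act g (snd x)} \<rightarrow> {l. l \<le> snd x}"
      using g act_le[of "inv g" _ "act g (snd x)"] by (auto simp: act_inv)
  qed (use g act_inv act_le in auto)
  ultimately show ?thesis
    unfolding psize_def pact_alt by (simp add: bij_betw_same_card[symmetric])
qed

abbreviation stab :: "'g set \<times> 'l \<Rightarrow> 'g set" where
  "stab u \<equiv> stabilizer G (pact G act) u"

lemma mem_stab: "g \<in> stab u \<longleftrightarrow> g \<in> carrier G \<and> pact G act g u = u"
  by (simp add: stabilizer_def)

lemma subgroup_stab:
  assumes "u \<in> pairs G Lf" shows "subgroup (stab u) G"
proof (rule subgroupI)
  have "\<one> \<in> stab u" using pact_one[OF assms] by (simp add: mem_stab)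
  then show "stab u \<noteq> {}" by blast
  show "inv a \<in> stab u" if "a \<in> stab u" for a
    using pact_inv[OF _ assms, of a] that by (auto simp: mem_stab)
qed (use pact_mult[OF _ _ assms] in \<open>auto simp: mem_stab\<close>)

lemma fst_subset_stab:
  assumes u: "u \<in> pairs G Lf" shows "fst u \<subseteq> stab u"
proof
  fix h assume h: "h \<in> fst u"
  interpret U: subgroup "fst u" G by (rule pairsD(1)[OF u])
  have hc: "h \<in> carrier G" using h by auto
  have "conj_set G h (fst u) = fst u"
  proof (intro equalityI subsetI)
    fix x assume "x \<in> conj_set G h (fst u)"
    then have x: "x \<in> carrier G" "inv h \<otimes> x \<otimes> h \<in> fst u" using mem_conj_set[OF hc U.subset] by auto
    then have "h \<otimes> (inv h \<otimes> x \<otimes> h) \<otimes> inv h \<in> fst u" using h by blast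
    moreover have "h \<otimes> (inv h \<otimes> x \<otimes> h) \<otimes> inv h = x"
      using x hc by (simp add: m_assoc mult_inv_cancel)
    ultimately show "x \<in> fst u" by simp
  qed (use h hc in \<open>auto simp: mem_conj_set[OF hc U.subset]\<close>)
  moreover have "act h (snd u) = snd u" using fixed[OF pairsD(1)[OF u] h] pairsD(3)[OF u] .
  ultimately show "h \<in> stab u" using hc by (simp add: mem_stab pact_alt)
qed

lemma stab_normalizes:
  assumes u: "u \<in> pairs G Lf" and g: "g \<in> stab u"
  shows "fst u #> g = g <# fst u"
proof -
  have gc: "g \<in> carrier G" and eq: "conj_set G g (fst u) = fst u"
    using g by (auto simp: mem_stab pact_alt prod_eq_iff)
  have "fst u #> g = conj_set G g (fst u) #> g" using eq by simp
  also have "\<dots> = g <# fst u"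
    using gc pairsD(2)[OF u] by (simp add: coset_mult_assoc l_coset_subset_G)
  finally show ?thesis .
qed

lemma normal_in_stab:
  assumes u: "u \<in> pairs G Lf" shows "fst u \<lhd> G\<lparr>carrier := stab u\<rparr>"
proof -
  interpret N: group "G\<lparr>carrier := stab u\<rparr>"
    by (rule subgroup_imp_group[OF subgroup_stab[OF u]])
  show ?thesis
  proof (rule normal.intro[OF _ N.is_group normal_axioms.intro])
    show "subgroup (fst u) (G\<lparr>carrier := stab u\<rparr>)"
      by (rule subgroup_incl[OF pairsD(1)[OF u] subgroup_stab[OF u] fst_subset_stab[OF u]])
    show "\<forall>x\<in>carrier (G\<lparr>carrier := stab u\<rparr>). fst u #>\<^bsub>G\<lparr>carrier := stab u\<rparr>\<^esub> x =
        x <#\<^bsub>G\<lparr>carrier := stab u\<rparr>\<^esub> fst u"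
      using stab_normalizes[OF u] by (simp add: r_coset_def l_coset_def)
  qed
qed

text \<open>The multiplication of cosets is the set product in \<open>G\<close>, so that an element of \<open>Wgrp\<close> can act on
  a left coset by the set product as well.\<close>

lemma Wgrp_simps:
  "carrier (Wgrp G act u) = {fst u #> g | g. g \<in> stab u}"
  "C \<otimes>\<^bsub>Wgrp G act u\<^esub> D = C <#> D" "\<one>\<^bsub>Wgrp G act u\<^esub> = fst u"
  by (auto simp: Wgrp_def FactGroup_def RCOSETS_def r_coset_def set_mult_def)

lemma group_Wgrp: "u \<in> pairs G Lf \<Longrightarrow> group (Wgrp G act u)"
  unfolding Wgrp_def by (rule normal.factorgroup_is_group[OF normal_in_stab])

lemma finite_stab: "finite (stab u)"
  using finite_carrier by (rule rev_finite_subset) (auto simp: mem_stab)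

lemma finite_Wgrp: "finite (carrier (Wgrp G act u))"
  using finite_stab by (simp add: Wgrp_simps setcompr_eq_image)

lemma WgrpE:
  assumes u: "u \<in> pairs G Lf" and C: "C \<in> carrier (Wgrp G act u)" and g: "g \<in> C"
  shows "g \<in> stab u" "C = fst u #> g"
proof -
  obtain x where x: "x \<in> stab u" "C = fst u #> x" using C by (auto simp: Wgrp_simps)
  interpret N: subgroup "stab u" G by (rule subgroup_stab[OF u])
  show "g \<in> stab u"
    using x g fst_subset_stab[OF u] by (auto simp: r_coset_def)
  show "C = fst u #> g"
    using x g repr_independence[OF _ _ pairsD(1)[OF u], of g x] N.subset by auto
qed

section \<open>Marks as numbers of fixed points\<close>

text \<open>The set counted by \<open>mark\<close>. In the case of the classical Burnside ring, where the lattice is trivial,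
  it is the set of fixed points of \<open>U\<close> on \<open>G/H\<close>.\<close>

definition fixpts :: "'g set \<times> 'l \<Rightarrow> 'g set \<times> 'l \<Rightarrow> 'g set set" where
  "fixpts u b = {g <# fst b | g. g \<in> carrier G \<and> pair_le u (pact G act g b)}"

lemma mark_eq_card_fixpts: "mark G act u b = card (fixpts u b)"
  by (simp add: mark_def fixpts_def pair_le_alt pact_alt case_prod_beta)

lemma finite_fixpts: "finite (fixpts u b)"
  using finite_carrier by (auto simp: fixpts_def setcompr_eq_image)

lemma lcoset_eq_iff:
  assumes H: "subgroup H G" and "g \<in> carrier G" "x \<in> carrier G"
  shows "g <# H = x <# H \<longleftrightarrow> inv g \<otimes> x \<in> H"
proof
  assume "g <# H = x <# H"
  then have "x \<in> g <# H" using lcos_self[OF assms(3) H] by simp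
  then show "inv g \<otimes> x \<in> H"
    using assms subgroup.subset[OF H] by (auto simp: l_coset_def m_assoc[symmetric])
next
  assume h: "inv g \<otimes> x \<in> H"
  have "x <# H = (g \<otimes> (inv g \<otimes> x)) <# H" using assms by (simp add: m_assoc[symmetric])
  also have "\<dots> = g <# ((inv g \<otimes> x) <# H)"
    using assms subgroup.subset[OF H] by (simp add: lcos_m_assoc)
  also have "(inv g \<otimes> x) <# H = H" using coset_join3[OF _ H h] assms by simp
  finally show "g <# H = x <# H" by simp
qed

text \<open>The condition defining \<open>fixpts\<close> does not depend on the representative of the coset,
  because \<open>H\<close> acts trivially on \<open>Lf H\<close>.\<close>

lemma lcoset_in_fixpts_iff:
  assumes b: "b \<in> pairs G Lf" and g: "g \<in> carrier G"
  shows "g <# fst b \<in> fixpts u b \<longleftrightarrow> pair_le u (pact G act g b)"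
proof
  assume "g <# fst b \<in> fixpts u b"
  then obtain x where x: "x \<in> carrier G" "g <# fst b = x <# fst b" "pair_le u (pact G act x b)"
    by (auto simp: fixpts_def)
  then have "inv g \<otimes> x \<in> stab b"
    using lcoset_eq_iff[OF pairsD(1)[OF b] g, of x] fst_subset_stab[OF b] by auto
  then have "pact G act g b = pact G act g (pact G act (inv g \<otimes> x) b)" by (simp add: mem_stab)
  also have "\<dots> = pact G act x b"
    using g x b by (simp add: pact_mult[symmetric] m_assoc[symmetric])
  finally show "pair_le u (pact G act g b)" using x by simp
qed (use g in \<open>auto simp: fixpts_def\<close>)

text \<open>As \<open>x\<close> normalizes \<open>U\<close>, the product is \<open>x U g H\<close>; and \<open>U g H = g H\<close> because \<open>U\<close> lies in the
  conjugate of \<open>H\<close> by \<open>g\<close>.\<close>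

lemma Wgrp_coset_mult_lcoset:
  assumes u: "u \<in> pairs G Lf" and b: "b \<in> pairs G Lf" and x: "x \<in> stab u"
    and g: "g \<in> carrier G" "pair_le u (pact G act g b)"
  shows "(fst u #> x) <#> (g <# fst b) = (x \<otimes> g) <# fst b"
proof -
  have xc: "x \<in> carrier G" using x by (simp add: mem_stab)
  note U = pairsD(2)[OF u] and H = pairsD(2)[OF b]
  have Ug: "fst u <#> (g <# fst b) = g <# fst b"
  proof (intro equalityI subsetI)
    fix y assume "y \<in> fst u <#> (g <# fst b)"
    then obtain v h where v: "v \<in> fst u" and h: "h \<in> fst b" and y: "y = v \<otimes> (g \<otimes> h)"
      by (auto simp: set_mult_def l_coset_def)
    have "inv g \<otimes> v \<otimes> g \<in> fst b"
      using v g mem_conj_set[OF g(1) H] by (auto simp: pair_le_alt pact_alt)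
    then have "inv g \<otimes> v \<otimes> g \<otimes> h \<in> fst b" using h subgroup.m_closed[OF pairsD(1)[OF b]] by blast
    moreover have "y = g \<otimes> (inv g \<otimes> v \<otimes> g \<otimes> h)"
      using v h y g U H by (simp add: subsetD m_assoc mult_inv_cancel)
    ultimately show "y \<in> g <# fst b" by (auto simp: l_coset_def)
  next
    fix y assume y: "y \<in> g <# fst b"
    then have "y \<in> carrier G" using g H by (auto simp: l_coset_def)
    then have "y = \<one> \<otimes> y" by simp
    then show "y \<in> fst u <#> (g <# fst b)"
      using y subgroup.one_closed[OF pairsD(1)[OF u]] unfolding set_mult_def by blast
  qed
  have "(fst u #> x) <#> (g <# fst b) = ({x} <#> fst u) <#> (g <# fst b)"
    using stab_normalizes[OF u x] by (simp add: l_coset_eq_set_mult)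
  also have "\<dots> = {x} <#> (fst u <#> (g <# fst b))"
    using xc U g H by (intro set_mult_assoc) (auto simp: l_coset_subset_G)
  also have "\<dots> = (x \<otimes> g) <# fst b"
    unfolding Ug using xc g H by (simp add: l_coset_eq_set_mult[symmetric] lcos_m_assoc)
  finally show ?thesis .
qed

lemma Wgrp_acts_on_fixpts:
  assumes u: "u \<in> pairs G Lf" and b: "b \<in> pairs G Lf"
  shows "C \<in> carrier (Wgrp G act u) \<Longrightarrow> D \<in> fixpts u b \<Longrightarrow> C <#> D \<in> fixpts u b"
    and "D \<in> fixpts u b \<Longrightarrow> \<one>\<^bsub>Wgrp G act u\<^esub> <#> D = D"
    and "C \<in> carrier (Wgrp G act u) \<Longrightarrow> C' \<in> carrier (Wgrp G act u) \<Longrightarrow> D \<in> fixpts u b \<Longrightarrow>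
      (C \<otimes>\<^bsub>Wgrp G act u\<^esub> C') <#> D = C <#> (C' <#> D)"
proof -
  assume C: "C \<in> carrier (Wgrp G act u)" and D: "D \<in> fixpts u b"
  obtain x where x: "x \<in> stab u" "C = fst u #> x" using C by (auto simp: Wgrp_simps)
  obtain g where g: "g \<in> carrier G" "D = g <# fst b" "pair_le u (pact G act g b)"
    using D by (auto simp: fixpts_def)
  have xc: "x \<in> carrier G" and xu: "pact G act x u = u" using x by (auto simp: mem_stab)
  have "pair_le u (pact G act (x \<otimes> g) b)"
    using pact_pair_le[OF xc g(3)] xu xc g b by (simp add: pact_mult)
  then show "C <#> D \<in> fixpts u b"
    using xc g x Wgrp_coset_mult_lcoset[OF u b x(1) g(1,3)] by (auto simp: fixpts_def)
next
  assume D: "D \<in> fixpts u b"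
  obtain g where g: "g \<in> carrier G" "D = g <# fst b" "pair_le u (pact G act g b)"
    using D by (auto simp: fixpts_def)
  have "\<one> \<in> stab u" using pact_one[OF u] by (simp add: mem_stab)
  then show "\<one>\<^bsub>Wgrp G act u\<^esub> <#> D = D"
    using Wgrp_coset_mult_lcoset[OF u b _ g(1,3), of \<one>] g pairsD(2)[OF u]
    by (simp add: Wgrp_simps)
next
  assume C: "C \<in> carrier (Wgrp G act u)" "C' \<in> carrier (Wgrp G act u)" and D: "D \<in> fixpts u b"
  have "C \<subseteq> carrier G" "C' \<subseteq> carrier G"
    using C pairsD(2)[OF u] by (auto simp: Wgrp_simps mem_stab r_coset_def)
  moreover have "D \<subseteq> carrier G" using D pairsD(2)[OF b] by (auto simp: fixpts_def l_coset_def)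
  ultimately show "(C \<otimes>\<^bsub>Wgrp G act u\<^esub> C') <#> D = C <#> (C' <#> D)"
    by (simp add: Wgrp_simps set_mult_assoc)
qed

text \<open>Translation by \<open>x\<close> is a bijection. This is why a mark may be evaluated at the representative of an
  orbit.\<close>

lemma card_fixpts_pact:
  assumes u: "u \<in> pairs G Lf" and b: "b \<in> pairs G Lf" and x: "x \<in> carrier G"
  shows "card (fixpts (pact G act x u) b) = card (fixpts u b)"
proof (rule bij_betw_same_card[OF bij_betw_byWitness])
  have step: "(\<lambda>D. y <# D) ` fixpts v b \<subseteq> fixpts (pact G act y v) b"
    if "y \<in> carrier G" "v \<in> pairs G Lf" for y v
  proof clarify
    fix D assume "D \<in> fixpts v b"
    then obtain g where g: "g \<in> carrier G" "D = g <# fst b" "pair_le v (pact G act g b)"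
      by (auto simp: fixpts_def)
    have "pair_le (pact G act y v) (pact G act (y \<otimes> g) b)"
      using pact_pair_le[OF that(1) g(3)] that g b by (simp add: pact_mult)
    then show "y <# D \<in> fixpts (pact G act y v) b"
      using that g pairsD(2)[OF b] lcoset_in_fixpts_iff[OF b, of "y \<otimes> g"] by (simp add: lcos_m_assoc)
  qed
  show "(\<lambda>D. inv x <# D) ` fixpts (pact G act x u) b \<subseteq> fixpts u b"
    using step[of "inv x" "pact G act x u"] x u by (simp add: pact_in_pairs pact_inv)
  have sub: "D \<subseteq> carrier G" if "D \<in> fixpts v b" for D v
    using that pairsD(2)[OF b] by (auto simp: fixpts_def l_coset_def)
  show "(\<lambda>D. x <# D) ` fixpts u b \<subseteq> fixpts (pact G act x u) b" by (rule step[OF x u])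
qed (use x pairsD(2)[OF b] in \<open>auto simp: fixpts_def lcos_m_assoc m_assoc[symmetric]\<close>)

text \<open>Triangularity of the table of marks: a coset in \<open>fixpts u b\<close> exhibits a conjugate of \<open>b\<close> above \<open>u\<close>,
  and conjugates have the same size.\<close>

lemma fixpts_nonempty_imp:
  assumes u: "u \<in> pairs G Lf" and b: "b \<in> pairs G Lf" and ne: "fixpts u b \<noteq> {}"
  shows "psize u < psize b \<or> u \<in> orbit G (pact G act) b"
proof -
  obtain g where g: "g \<in> carrier G" "pair_le u (pact G act g b)" using ne by (auto simp: fixpts_def)
  show ?thesis
  proof (cases "u = pact G act g b")
    case True then show ?thesis using g by (auto simp: orbit_def)
  next
    case False
    then show ?thesis
      using psize_less[OF g(2) pairsD(4)[OF pact_in_pairs[OF g(1) b]]] psize_pact[OF g(1) b] by simp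
  qed
qed

text \<open>The diagonal marks are the orders of the groups \<open>Wgrp\<close>: a conjugate of \<open>u\<close> lying above \<open>u\<close> has the
  same size, hence equals \<open>u\<close>.\<close>

lemma fixpts_self:
  assumes u: "u \<in> pairs G Lf" shows "fixpts u u = carrier (Wgrp G act u)"
proof -
  have "g \<in> stab u" if g: "g \<in> carrier G" "pair_le u (pact G act g u)" for g
  proof (rule ccontr)
    assume "g \<notin> stab u"
    then have "u \<noteq> pact G act g u" using g by (auto simp: mem_stab)
    then show False
      using psize_less[OF g(2) pairsD(4)[OF pact_in_pairs[OF g(1) u]]] psize_pact[OF g(1) u] by simp
  qed
  then have eq: "fixpts u u = {g <# fst u | g. g \<in> stab u}"
    by (fastforce simp: fixpts_def mem_stab pair_le_alt)
  note eq
  also have "{g <# fst u | g. g \<in> stab u} = {fst u #> g | g. g \<in> stab u}" using stab_normalizes[OF u] by metis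
  finally show ?thesis by (simp add: Wgrp_simps)
qed

end

section \<open>Fixed points of one element and closures\<close>

lemma Sup_fin_in_sublattice:
  fixes S :: "'l::{finite,lattice} set"
  assumes "sublattice S" "S \<noteq> {}" shows "Sup_fin S \<in> S"
proof -
  have "Sup_fin F \<in> S" if "finite F" "F \<noteq> {}" "F \<subseteq> S" for F
    using that
  proof (induction F rule: finite_ne_induct)
    case (insert x F)
    then show ?case using assms(1) by (simp add: sublattice_def)
  qed auto
  then show ?thesis using assms(2) finite by blast
qed

locale pair_family = admissible_family G act Lf
  for G :: "('g, 'm) monoid_scheme" (structure)
    and act :: "'g \<Rightarrow> 'l::{finite,lattice} \<Rightarrow> 'l"
    and Lf :: "'g set \<Rightarrow> 'l set" +
  fixes \<XX> :: "('g set \<times> 'l) set"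
  assumes X_sub: "\<XX> \<subseteq> pairs G Lf"
    and X_closed: "\<And>g x. g \<in> carrier G \<Longrightarrow> x \<in> \<XX> \<Longrightarrow> pact G act g x \<in> \<XX>"
    and X_min: "\<And>u g. u \<in> \<XX> \<Longrightarrow> g \<in> stabilizer G (pact G act) u
                  \<Longrightarrow> \<exists>!m. minimal_pair (upper_pairs G Lf \<XX> g u) m"
begin

lemma cyc_join_facts:
  assumes "u \<in> pairs G Lf" "x \<in> stab u"
  shows "subgroup (cyc_join G x (fst u)) G" "x \<in> cyc_join G x (fst u)"
    "fst u \<subseteq> cyc_join G x (fst u)"
    "\<And>K. subgroup K G \<Longrightarrow> cyc_join G x (fst u) \<subseteq> K \<longleftrightarrow> x \<in> K \<and> fst u \<subseteq> K"
proof -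
  have x: "x \<in> carrier G" "conj_set G x (fst u) = fst u"
    using assms(2) by (auto simp: mem_stab pact_alt prod_eq_iff)
  note eq = cyc_join_eq_generate[OF is_group pairsD(1)[OF assms(1)] x]
  show "subgroup (cyc_join G x (fst u)) G"
    unfolding eq using x pairsD(2)[OF assms(1)] by (intro generate_is_subgroup) auto
  show 1: "x \<in> cyc_join G x (fst u)" "fst u \<subseteq> cyc_join G x (fst u)"
    unfolding eq by (auto intro: generate.incl)
  show "cyc_join G x (fst u) \<subseteq> K \<longleftrightarrow> x \<in> K \<and> fst u \<subseteq> K" if "subgroup K G" for K
    using 1 generate_subgroup_incl[OF _ that, of "insert x (fst u)"] unfolding eq by blast
qed

text \<open>The axioms \<open>inf_Sup\<close> and \<open>Sup_mono\<close> of an admissible family imply that an element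
  of a larger \<open>Lf K\<close> lying above \<open>t\<close> also lies above some element of \<open>Lf (cyc_join G x U)\<close>
  above \<open>t\<close>, so the infimum in \<open>lat_inf\<close> puts no condition on \<open>K\<close> beyond \<open>t \<le> s\<close>.\<close>

lemma mem_upper_pairs_iff:
  assumes u: "u \<in> \<XX>" and x: "x \<in> stab u"
  shows "k \<in> upper_pairs G Lf \<XX> x u \<longleftrightarrow> k \<in> \<XX> \<and> pair_le u k \<and> x \<in> fst k"
proof -
  have up: "u \<in> pairs G Lf" using u X_sub by auto
  define L where "L = cyc_join G x (fst u)"
  define A where "A = {s \<in> Lf L. snd u \<le> s}"
  note L = cyc_join_facts[OF up x, folded L_def]
  have t: "snd u \<le> Sup_fin (Lf L)"
  proof -
    have "snd u \<le> Sup_fin (Lf (fst u))" using pairsD(3)[OF up] by (simp add: Sup_fin.coboundedI)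
    also have "\<dots> \<le> Sup_fin (Lf L)" by (rule Sup_mono[OF L(1) pairsD(1)[OF up] L(3)])
    finally show ?thesis .
  qed
  then have A: "A \<noteq> {}"
    using Sup_fin_in_sublattice[OF sublat[OF L(1)] nonempty[OF L(1)]] by (auto simp: A_def)
  have lat: "lat_inf G Lf x u = Inf_fin A"
    by (simp add: lat_inf_def case_prod_beta A_def L_def)
  have "snd u \<le> Inf_fin A" using A by (intro Inf_fin.boundedI) (auto simp: A_def)
  moreover have "Inf_fin A \<le> snd k" if k: "k \<in> pairs G Lf" "L \<subseteq> fst k" "snd u \<le> snd k" for k
  proof -
    have "inf (snd k) (Sup_fin (Lf L)) \<in> A"
      using inf_Sup[OF pairsD(1)[OF k(1)] L(1) k(2) pairsD(3)[OF k(1)]] t k(3) by (simp add: A_def)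
    then have "Inf_fin A \<le> inf (snd k) (Sup_fin (Lf L))" by (intro Inf_fin.coboundedI) auto
    then show ?thesis by simp
  qed
  ultimately have "Inf_fin A \<le> snd k \<longleftrightarrow> snd u \<le> snd k" if "k \<in> pairs G Lf" "L \<subseteq> fst k"
    using that order_trans by blast
  then have "L \<subseteq> fst k \<and> Inf_fin A \<le> snd k \<longleftrightarrow> x \<in> fst k \<and> fst u \<subseteq> fst k \<and> snd u \<le> snd k"
    if "k \<in> pairs G Lf"
    using that L(4)[OF pairsD(1)[OF that]] by blast
  then show ?thesis
    using X_sub by (auto simp: upper_pairs_def pair_le_alt lat L_def[symmetric])
qed

text \<open>In a finite poset a unique minimal element is the least element. So a pair in \<open>\<XX>\<close> lies above the
  closure as soon as it lies above \<open>u\<close> and its subgroup contains \<open>x\<close>.\<close>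

lemma closure_pair_facts:
  assumes u: "u \<in> \<XX>" and x: "x \<in> stab u"
  shows "closure_pair G Lf \<XX> x u \<in> \<XX>" "pair_le u (closure_pair G Lf \<XX> x u)"
    "x \<in> fst (closure_pair G Lf \<XX> x u)"
    "\<And>k. k \<in> \<XX> \<Longrightarrow> pair_le u k \<Longrightarrow> x \<in> fst k \<Longrightarrow> pair_le (closure_pair G Lf \<XX> x u) k"
proof -
  let ?A = "upper_pairs G Lf \<XX> x u" and ?c = "closure_pair G Lf \<XX> x u"
  have c: "minimal_pair ?A ?c" unfolding closure_pair_def by (rule theI'[OF X_min[OF u x]])
  then have "?c \<in> ?A" by (simp add: minimal_pair_def)
  then show "?c \<in> \<XX>" "pair_le u ?c" "x \<in> fst ?c" using mem_upper_pairs_iff[OF u x] by auto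
  fix k assume "k \<in> \<XX>" "pair_le u k" "x \<in> fst k"
  then have k: "k \<in> ?A" using mem_upper_pairs_iff[OF u x] by auto
  \<comment> \<open>An element of least size below \<open>k\<close> is minimal, hence the only minimal element.\<close>
  obtain l where l: "l \<in> ?A" "pair_le l k"
    and least: "\<And>l'. l' \<in> ?A \<Longrightarrow> pair_le l' k \<Longrightarrow> psize l \<le> psize l'"
    using ex_has_least_nat[of "\<lambda>l. l \<in> ?A \<and> pair_le l k" k psize] k by (auto simp: pair_le_alt)
  have "l \<in> pairs G Lf" using l X_sub by (auto simp: upper_pairs_def)
  then have "finite (fst l)" by (rule pairsD)
  then have "minimal_pair ?A l"
    unfolding minimal_pair_def using l least psize_less pair_le_trans by (meson leD)
  then have "l = ?c" using c X_min[OF u x] by blast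
  then show "pair_le ?c k" using l by simp
qed

lemma closure_pair_trivial:
  assumes u: "u \<in> \<XX>" and x: "x \<in> fst u"
  shows "closure_pair G Lf \<XX> x u = u"
proof -
  have xs: "x \<in> stab u" using fst_subset_stab u x X_sub by blast
  have "pair_le (closure_pair G Lf \<XX> x u) u"
    using closure_pair_facts(4)[OF u xs u _ x] by (simp add: pair_le_alt)
  then show ?thesis
    using closure_pair_facts(2)[OF u xs] by (auto simp: pair_le_alt prod_eq_iff)
qed

text \<open>The key identity. A coset \<open>gH\<close> counted by the mark at \<open>u\<close> is fixed by \<open>x\<close> if and only if \<open>x\<close> lies in
  the conjugate of \<open>H\<close> by \<open>g\<close>, that is, if and only if the conjugate of \<open>b\<close>, which lies in \<open>\<XX>\<close>, is
  above the closure. So the entries of a column of the table of marks at the closures are the numbers of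
  fixed points of the elements of a group acting on one set, and Burnside's lemma applies to them.\<close>

lemma fixed_points_eq_fixpts_closure:
  assumes u: "u \<in> \<XX>" and b: "b \<in> \<XX>" and x: "x \<in> stab u"
  shows "{D \<in> fixpts u b. (fst u #> x) <#> D = D} = fixpts (closure_pair G Lf \<XX> x u) b"
proof -
  have up: "u \<in> pairs G Lf" and bp: "b \<in> pairs G Lf" using u b X_sub by auto
  have xc: "x \<in> carrier G" using x by (simp add: mem_stab)
  note H = pairsD(1,2)[OF bp]
  note c = closure_pair_facts[OF u x]
  have iff: "pair_le u (pact G act g b) \<and> (fst u #> x) <#> (g <# fst b) = g <# fst b \<longleftrightarrow>
      pair_le (closure_pair G Lf \<XX> x u) (pact G act g b)" if g: "g \<in> carrier G" for g
  proof -
    have "(fst u #> x) <#> (g <# fst b) = g <# fst b \<longleftrightarrow> x \<in> fst (pact G act g b)"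
      if le: "pair_le u (pact G act g b)"
    proof -
      have "(fst u #> x) <#> (g <# fst b) = g <# fst b \<longleftrightarrow> g <# fst b = (x \<otimes> g) <# fst b"
        using Wgrp_coset_mult_lcoset[OF up bp x g le] by auto
      also have "\<dots> \<longleftrightarrow> inv g \<otimes> x \<otimes> g \<in> fst b"
        using lcoset_eq_iff[OF H(1) g, of "x \<otimes> g"] g xc by (simp add: m_assoc)
      also have "\<dots> \<longleftrightarrow> x \<in> fst (pact G act g b)"
        using mem_conj_set[OF g H(2), of x] xc by (simp add: pact_alt)
      finally show ?thesis .
    qed
    moreover have "pact G act g b \<in> \<XX>" using X_closed[OF g b] .
    ultimately show ?thesis
      using c(2,3) c(4)[of "pact G act g b"] pair_le_trans[OF c(2)]
      by (metis pair_le_alt subsetD)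
  qed
  show ?thesis
  proof (intro equalityI subsetI)
    fix D assume "D \<in> {D \<in> fixpts u b. (fst u #> x) <#> D = D}"
    then show "D \<in> fixpts (closure_pair G Lf \<XX> x u) b" using iff by (auto simp: fixpts_def)
  next
    fix D assume "D \<in> fixpts (closure_pair G Lf \<XX> x u) b"
    then show "D \<in> {D \<in> fixpts u b. (fst u #> x) <#> D = D}" using iff by (auto simp: fixpts_def)
  qed
qed

end

section \<open>The exact sequence\<close>

locale obstruction_data = pair_family G act Lf \<XX>
  for G :: "('g, 'm) monoid_scheme" (structure)
    and act :: "'g \<Rightarrow> 'l::{finite,lattice} \<Rightarrow> 'l"
    and Lf :: "'g set \<Rightarrow> 'l set"
    and \<XX> :: "('g set \<times> 'l) set" +
  fixes p :: enat and R B :: "('g set \<times> 'l) set" and Syl :: "'g set \<times> 'l \<Rightarrow> 'g set set"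
  assumes p: "valid_place p"
    and reps: "orbit_reps G act (pairs G Lf) R"
    and syl: "\<And>x. x \<in> pairs G Lf \<Longrightarrow> sylow_part p (Wgrp G act x) (Syl x)"
    and B: "B = R \<inter> \<XX>"
begin

abbreviation "Zp \<equiv> carrier (Zloc p)"

lemma B_sub: "B \<subseteq> \<XX>" "b \<in> B \<Longrightarrow> b \<in> \<XX>" "b \<in> B \<Longrightarrow> b \<in> pairs G Lf"
  using B X_sub by auto

lemma finite_B: "finite B"
proof (rule finite_subset)
  show "B \<subseteq> Pow (carrier G) \<times> UNIV"
    using pairsD(2)[OF B_sub(3)] by (fastforce simp: mem_Times_iff)
qed (simp add: finite_carrier)

definition rep :: "'g set \<times> 'l \<Rightarrow> 'g set \<times> 'l" where
  "rep v = (THE r. r \<in> B \<and> r \<in> orbit G (pact G act) v)"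

lemma ex1_rep: "v \<in> \<XX> \<Longrightarrow> \<exists>!r. r \<in> B \<and> r \<in> orbit G (pact G act) v"
  using reps X_sub X_closed unfolding orbit_reps_def B orbit_def by blast

lemma rep_facts:
  assumes "v \<in> \<XX>" shows "rep v \<in> B" "\<exists>g\<in>carrier G. rep v = pact G act g v"
  using theI'[OF ex1_rep[OF assms], folded rep_def] by (auto simp: orbit_def)

lemma rep_unique: "v \<in> \<XX> \<Longrightarrow> r \<in> B \<Longrightarrow> r \<in> orbit G (pact G act) v \<Longrightarrow> rep v = r"
  unfolding rep_def by (rule the1_equality[OF ex1_rep]) auto

lemma self_in_orbit: "v \<in> \<XX> \<Longrightarrow> v \<in> orbit G (pact G act) v"
  using pact_one X_sub unfolding orbit_def by (metis (mono_tags, lifting) mem_Collect_eq one_closed subsetD)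

lemma psize_rep: "v \<in> \<XX> \<Longrightarrow> psize (rep v) = psize v"
  using rep_facts(2) psize_pact X_sub by (metis subsetD)

lemma mark_rep: "v \<in> \<XX> \<Longrightarrow> b \<in> \<XX> \<Longrightarrow> mark G act (rep v) b = mark G act v b"
  using rep_facts(2) card_fixpts_pact X_sub unfolding mark_eq_card_fixpts by (metis subsetD)

lemma subgroup_Syl:
  assumes "u \<in> pairs G Lf" shows "subgroup (Syl u) (Wgrp G act u)"
  using syl[OF assms] group.subgroup_self[OF group_Wgrp[OF assms]]
  by (auto simp: sylow_part_def split: enat.splits)

lemma Syl_sub: "u \<in> pairs G Lf \<Longrightarrow> Syl u \<subseteq> carrier (Wgrp G act u)"
  by (rule subgroup.subset[OF subgroup_Syl])

lemma finite_Syl: "u \<in> pairs G Lf \<Longrightarrow> finite (Syl u)"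
  using Syl_sub finite_Wgrp finite_subset by blast

lemma card_Syl_pos: "u \<in> pairs G Lf \<Longrightarrow> card (Syl u) > 0"
  using finite_Syl[of u] subgroup.one_closed[OF subgroup_Syl, of u] by (auto simp: card_gt_0_iff)

text \<open>The index of a Sylow subgroup is prime to \<open>p\<close> (and \<open>1\<close> for \<open>p = \<infinity>\<close>), hence a unit in the localization; so the congruence
  modulus at \<open>u\<close> is associated to the diagonal mark.\<close>

lemma Syl_index_unit:
  assumes u: "u \<in> pairs G Lf"
  shows "of_nat (card (Syl u)) / of_nat (order (Wgrp G act u)) \<in> Zp"
proof -
  have pos: "order (Wgrp G act u) > 0"
    using monoid.order_gt_0_iff_finite[OF group.is_monoid[OF group_Wgrp[OF u]]] finite_Wgrp by simp
  obtain k where k: "order (Wgrp G act u) = card (Syl u) * k" "int k \<in> denominators p"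
  proof (cases p)
    case infinity
    then have "Syl u = carrier (Wgrp G act u)" using syl[OF u] by (simp add: sylow_part_def)
    then show ?thesis using that[of 1] infinity one_in_denominators[OF p] by (simp add: order_def)
  next
    case (enat q)
    then have q: "normalization_semidom_class.prime q" using p by auto
    have "card (Syl u) = q ^ multiplicity q (order (Wgrp G act u))"
      using syl[OF u] enat by (simp add: sylow_part_def)
    moreover obtain k where "order (Wgrp G act u) = q ^ multiplicity q (order (Wgrp G act u)) * k"
      "\<not> q dvd k"
      using multiplicity_decompose'[of "order (Wgrp G act u)" q] pos q prime_gt_1_nat[of q]
      by (metis nat_dvd_1_iff_1 less_irrefl less_numeral_extra(3))
    ultimately show ?thesis using that[of k] enat pos by (auto simp: denominators_def)
  qed
  have "of_nat (card (Syl u)) / of_nat (order (Wgrp G act u)) = 1 / (of_int (int k) :: rat)"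
    using card_Syl_pos[OF u] by (simp add: k(1))
  then show ?thesis using inverse_in_Zloc[OF k(2)] by simp
qed

lemma Syl_burnside:
  assumes u: "u \<in> pairs G Lf" and fin: "finite E"
    and act: "\<And>C x. C \<in> carrier (Wgrp G act u) \<Longrightarrow> x \<in> E \<Longrightarrow> a C x \<in> E"
      "\<And>x. x \<in> E \<Longrightarrow> a \<one>\<^bsub>Wgrp G act u\<^esub> x = x"
      "\<And>C D x. C \<in> carrier (Wgrp G act u) \<Longrightarrow> D \<in> carrier (Wgrp G act u) \<Longrightarrow> x \<in> E \<Longrightarrow>
        a (C \<otimes>\<^bsub>Wgrp G act u\<^esub> D) x = a C (a D x)"
  shows "card (Syl u) dvd (\<Sum>C\<in>Syl u. card {x \<in> E. a C x = x})"
proof -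
  let ?S = "(Wgrp G act u)\<lparr>carrier := Syl u\<rparr>"
  have "group ?S" by (rule group.subgroup_imp_group[OF group_Wgrp[OF u] subgroup_Syl[OF u]])
  then have "order ?S dvd (\<Sum>C\<in>carrier ?S. card {x \<in> E. a C x = x})"
    using act subsetD[OF Syl_sub[OF u]] fin finite_Syl[OF u]
    by (intro order_dvd_sum_card_fixed_points) simp_all
  then show ?thesis by (simp add: order_def)
qed

text \<open>The position in \<open>B\<close> from which \<open>psi\<close> reads the summand of the coset \<open>C\<close>. The choice of the element
  of \<open>C\<close> is the one made in \<open>psi\<close>.\<close>

definition closure_rep :: "'g set \<times> 'l \<Rightarrow> 'g set \<Rightarrow> 'g set \<times> 'l" where
  "closure_rep u C = rep (closure_pair G Lf \<XX> (SOME g. g \<in> C) u)"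

lemma some_in_Syl_elem:
  assumes u: "u \<in> pairs G Lf" and C: "C \<in> Syl u"
  shows "(SOME g. g \<in> C) \<in> stab u" "C = fst u #> (SOME g. g \<in> C)"
proof -
  have CW: "C \<in> carrier (Wgrp G act u)" using C Syl_sub[OF u] by auto
  then obtain x where "x \<in> stab u" "C = fst u #> x" by (auto simp: Wgrp_simps)
  then have "x \<in> C"
    using rcos_self[OF _ pairsD(1)[OF u], of x] by (simp add: mem_stab)
  then have "(SOME g. g \<in> C) \<in> C" by (rule someI)
  then show "(SOME g. g \<in> C) \<in> stab u" "C = fst u #> (SOME g. g \<in> C)"
    using WgrpE[OF u CW] by blast+
qed

lemma closure_rep_in_B: "u \<in> B \<Longrightarrow> C \<in> Syl u \<Longrightarrow> closure_rep u C \<in> B"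
  unfolding closure_rep_def
  by (intro rep_facts closure_pair_facts some_in_Syl_elem B_sub)

lemma mark_closure_rep:
  assumes "u \<in> B" "b \<in> B" "C \<in> Syl u"
  shows "mark G act (closure_rep u C) b = card {D \<in> fixpts u b. C <#> D = D}"
proof -
  note g = some_in_Syl_elem[OF B_sub(3)[OF assms(1)] assms(3)]
  have "mark G act (closure_rep u C) b = card (fixpts (closure_pair G Lf \<XX> (SOME g. g \<in> C) u) b)"
    using mark_rep closure_pair_facts(1) g(1) B_sub(2) assms
    by (simp add: closure_rep_def mark_eq_card_fixpts[symmetric])
  also have "\<dots> = card {D \<in> fixpts u b. C <#> D = D}"
    using fixed_points_eq_fixpts_closure[OF B_sub(2)[OF assms(1)] B_sub(2)[OF assms(2)] g(1)]
    unfolding g(2)[symmetric] by simp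
  finally show ?thesis .
qed

text \<open>The trivial coset \<open>fst u\<close> contributes \<open>u\<close> itself to the congruence at \<open>u\<close>. Any other coset contains
  only elements outside \<open>U\<close>, so its closure is strictly larger than \<open>u\<close>.\<close>

sublocale triangular_system Zp B "\<lambda>u b. of_nat (mark G act u b)" Syl closure_rep fst
  "\<lambda>u. of_nat (card (Syl u))" psize
proof
  fix u b assume u: "u \<in> B" and b: "b \<in> B"
  show "of_nat (mark G act u b) \<in> Zp" using of_int_in_Zloc[OF p, of "int (mark G act u b)"] by simp
  assume "of_nat (mark G act u b) \<noteq> (0::rat)"
  then have "fixpts u b \<noteq> {}" by (auto simp: mark_eq_card_fixpts)
  then have "psize u < psize b \<or> u \<in> orbit G (pact G act) b"
    using fixpts_nonempty_imp u b B_sub(3) by blast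
  then show "u = b \<or> psize u < psize b"
    using rep_unique[OF B_sub(2)[OF b]] u b self_in_orbit[OF B_sub(2)[OF b]] by metis
next
  fix u assume u: "u \<in> B"
  have diag: "mark G act u u = order (Wgrp G act u)"
    using fixpts_self[OF B_sub(3)[OF u]] by (simp add: mark_eq_card_fixpts order_def)
  show "of_nat (mark G act u u) \<noteq> (0::rat)"
    using monoid.order_gt_0_iff_finite[OF group.is_monoid[OF group_Wgrp[OF B_sub(3)[OF u]]]] finite_Wgrp
    by (simp add: diag)
  show "of_nat (card (Syl u)) / of_nat (mark G act u u) \<in> Zp"
    unfolding diag by (rule Syl_index_unit[OF B_sub(3)[OF u]])
  show one: "fst u \<in> Syl u"
    using subgroup.one_closed[OF subgroup_Syl[OF B_sub(3)[OF u]]] by (simp add: Wgrp_simps)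
  have "\<one> \<in> fst u" using subgroup.one_closed[OF pairsD(1)[OF B_sub(3)[OF u]]] .
  then have some: "(SOME g. g \<in> fst u) \<in> fst u" by (rule someI)
  show "closure_rep u (fst u) = u"
    unfolding closure_rep_def closure_pair_trivial[OF B_sub(2)[OF u] some]
    using rep_unique[OF B_sub(2)[OF u] u self_in_orbit[OF B_sub(2)[OF u]]] .
  fix C assume C: "C \<in> Syl u"
  then show "closure_rep u C \<in> B" by (rule closure_rep_in_B[OF u])
  assume ne: "C \<noteq> fst u"
  define g where "g = (SOME g. g \<in> C)"
  note g = some_in_Syl_elem[OF B_sub(3)[OF u] C, folded g_def]
  note c = closure_pair_facts[OF B_sub(2)[OF u] g(1)]
  have "g \<notin> fst u"
  proof
    assume "g \<in> fst u"
    then have "C = fst u" using g coset_join2[OF _ pairsD(1)[OF B_sub(3)[OF u]]] by (simp add: mem_stab)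
    with ne show False ..
  qed
  then have "closure_pair G Lf \<XX> g u \<noteq> u" using c(3) by metis
  moreover have "finite (fst (closure_pair G Lf \<XX> g u))" using c(1) X_sub pairsD(4) by blast
  ultimately have "psize u < psize (closure_pair G Lf \<XX> g u)" using psize_less[OF c(2)] by metis
  then show "psize u < psize (closure_rep u C)"
    using psize_rep[OF c(1)] by (simp add: closure_rep_def g_def)
qed (use finite_B finite_Syl B_sub(3) Zloc_add_closed[OF p] Zloc_mult_closed[OF p]
    Zloc_minus_closed[OF p] of_int_in_Zloc[OF p, of 0] in auto)

lemma congruentI_dvd:
  assumes "\<And>u. u \<in> B \<Longrightarrow> \<exists>k::nat. (\<Sum>C\<in>Syl u. y (closure_rep u C)) = of_nat k \<and> card (Syl u) dvd k"
  shows "congruent y"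
  unfolding congruent_def
proof
  fix u assume "u \<in> B"
  then obtain k where k: "(\<Sum>C\<in>Syl u. y (closure_rep u C)) = of_nat k" "card (Syl u) dvd k"
    using assms by blast
  then obtain j where "k = card (Syl u) * j" by auto
  then have "(\<Sum>C\<in>Syl u. y (closure_rep u C)) = of_int (int j) * of_nat (card (Syl u))"
    using k by simp
  then show "\<exists>a\<in>Zp. (\<Sum>C\<in>Syl u. y (closure_rep u C)) = a * of_nat (card (Syl u))"
    using of_int_in_Zloc[OF p] by blast
qed

lemma congruent_one: "congruent (\<lambda>_. 1)"
  by (rule congruentI_dvd) (auto intro: exI[of _ "card (Syl _)"])

lemma congruent_mark:
  assumes b: "b \<in> B" shows "congruent (\<lambda>u. of_nat (mark G act u b))"
proof (rule congruentI_dvd)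
  fix u assume u: "u \<in> B"
  have "card (Syl u) dvd (\<Sum>C\<in>Syl u. card {D \<in> fixpts u b. C <#> D = D})"
    using Wgrp_acts_on_fixpts[OF B_sub(3)[OF u] B_sub(3)[OF b]]
    by (intro Syl_burnside B_sub(3) u finite_fixpts) auto
  then show "\<exists>k::nat. (\<Sum>C\<in>Syl u. of_nat (mark G act (closure_rep u C) b)) = (of_nat k :: rat) \<and>
      card (Syl u) dvd k"
    using mark_closure_rep[OF u b] by (intro exI conjI) (auto simp flip: of_nat_sum)
qed

text \<open>A product of two marks counts fixed points on a product of two sets, to which Burnside's lemma applies
  again. It follows that the image of \<open>phi\<close> is a subring of the ghost ring, although \<open>\<XX>\<close> need not be
  closed under any operation that would give a product of basis elements.\<close>

lemma congruent_mark_mult: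
  assumes b: "b \<in> B" and b': "b' \<in> B"
  shows "congruent (\<lambda>u. of_nat (mark G act u b) * of_nat (mark G act u b'))"
proof (rule congruentI_dvd)
  fix u assume u: "u \<in> B"
  let ?E = "fixpts u b \<times> fixpts u b'" and ?a = "\<lambda>C (D, D'). (C <#> D, C <#> D')"
  have "card (Syl u) dvd (\<Sum>C\<in>Syl u. card {x \<in> ?E. ?a C x = x})"
    using Wgrp_acts_on_fixpts[OF B_sub(3)[OF u] B_sub(3)[OF b]]
      Wgrp_acts_on_fixpts[OF B_sub(3)[OF u] B_sub(3)[OF b']]
    by (intro Syl_burnside B_sub(3) u finite_cartesian_product finite_fixpts) auto
  moreover have "card {x \<in> ?E. ?a C x = x} =
      mark G act (closure_rep u C) b * mark G act (closure_rep u C) b'" if "C \<in> Syl u" for C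
  proof -
    have "{x \<in> ?E. ?a C x = x} = {D \<in> fixpts u b. C <#> D = D} \<times> {D \<in> fixpts u b'. C <#> D = D}"
      by auto
    then show ?thesis
      using mark_closure_rep[OF u b that] mark_closure_rep[OF u b' that]
      by (simp add: card_cartesian_product)
  qed
  ultimately show "\<exists>k::nat. (\<Sum>C\<in>Syl u. of_nat (mark G act (closure_rep u C) b) *
      of_nat (mark G act (closure_rep u C) b')) = (of_nat k :: rat) \<and> card (Syl u) dvd k"
    by (intro exI conjI) (auto simp flip: of_nat_mult of_nat_sum)
qed

lemma Ghost_simps:
  "carrier (Ghost p B) = (\<Pi>\<^sub>E b\<in>B. Zp)"
  "x \<otimes>\<^bsub>Ghost p B\<^esub> y = (\<lambda>b\<in>B. x b * y b)" "x \<oplus>\<^bsub>Ghost p B\<^esub> y = (\<lambda>b\<in>B. x b + y b)"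
  "\<one>\<^bsub>Ghost p B\<^esub> = (\<lambda>b\<in>B. 1)" "a \<odot>\<^bsub>Ghost p B\<^esub> x = (\<lambda>b\<in>B. a * x b)"
  by (simp_all add: Ghost_def prod_module_def self_module_def)

lemma algebra_Ghost: "algebra (Zloc p) (Ghost p B)"
  unfolding Ghost_def using cring_Zloc[OF p]
  by (intro algebra_prod_module algebra_self_module)

lemma ideal_Obs_ideal: "ideal (Obs_ideal p Syl u) (Zloc p)"
  unfolding Obs_ideal_def
  using of_int_in_Zloc[OF p, of "int (card (Syl u))"]
  by (intro cring.cgenideal_ideal cring_Zloc p) simp

lemma mem_Obs_ideal: "z \<in> Obs_ideal p Syl u \<longleftrightarrow> (\<exists>a\<in>Zp. z = a * of_nat (card (Syl u)))"
  by (auto simp: Obs_ideal_def cgenideal_def)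

lemma module_Obs: "module (Zloc p) (Obs p Syl B)"
  unfolding Obs_def using cring_Zloc[OF p]
  by (intro algebra.module algebra_prod_module algebra_quot_module ideal_Obs_ideal)

lemma mem_free_module:
  "f \<in> carrier (free_module p B) \<longleftrightarrow>
    (\<forall>b. Poly_Mapping.lookup f b \<in> Zp) \<and> Poly_Mapping.keys f \<subseteq> B"
  by (auto simp: free_module_def)

lemma phi_eq_sum:
  assumes "Poly_Mapping.keys f \<subseteq> B"
  shows "phi G act B f = (\<lambda>u\<in>B. \<Sum>b\<in>B. Poly_Mapping.lookup f b * of_nat (mark G act u b))"
  unfolding phi_def using assms finite_B
  by (intro restrict_ext sum.mono_neutral_left) (auto simp: in_keys_iff)

lemma phi_linear: "phi G act B \<in> linear_maps (Zloc p) (free_module p B) (Ghost p B)"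
proof -
  have ops: "x \<oplus>\<^bsub>free_module p B\<^esub> y = x + y"
    "a \<odot>\<^bsub>free_module p B\<^esub> x = Poly_Mapping.map (\<lambda>c. a * c) x" for x y a
    by (simp_all add: free_module_def)
  have keys: "Poly_Mapping.keys (x + y) \<subseteq> B" "Poly_Mapping.keys (Poly_Mapping.map (\<lambda>c. a * c) x) \<subseteq> B"
    if "Poly_Mapping.keys x \<subseteq> B" "Poly_Mapping.keys y \<subseteq> B" for x y :: "_ \<Rightarrow>\<^sub>0 rat" and a
    using that keys_add[of x y] by (auto simp: in_keys_iff lookup_map_mult)
  show ?thesis
    unfolding linear_maps_def
  proof (intro CollectI conjI ballI funcsetI)
    fix x assume "x \<in> carrier (free_module p B)"
    then show "phi G act B x \<in> carrier (Ghost p B)"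
      by (auto simp: mem_free_module phi_eq_sum Ghost_simps intro!: sum_in_A mult_A M_in_A)
  next
    fix x y assume "x \<in> carrier (free_module p B)" "y \<in> carrier (free_module p B)"
    then show "phi G act B (x \<oplus>\<^bsub>free_module p B\<^esub> y) = phi G act B x \<oplus>\<^bsub>Ghost p B\<^esub> phi G act B y"
      by (auto simp: mem_free_module phi_eq_sum Ghost_simps ops keys lookup_add distrib_right
          sum.distrib)
  next
    fix a x assume "x \<in> carrier (free_module p B)"
    then show "phi G act B (a \<odot>\<^bsub>free_module p B\<^esub> x) = a \<odot>\<^bsub>Ghost p B\<^esub> phi G act B x"
      by (auto simp: mem_free_module phi_eq_sum Ghost_simps ops keys lookup_map_mult
          sum_distrib_left mult.assoc)
  qed
qed

text \<open>The table of marks is triangular with nonzero diagonal.\<close>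

lemma phi_inj: "inj_on (phi G act B) (carrier (free_module p B))"
proof (rule inj_onI)
  fix x y assume x: "x \<in> carrier (free_module p B)" and y: "y \<in> carrier (free_module p B)"
    and eq: "phi G act B x = phi G act B y"
  have "(\<Sum>b\<in>B. (Poly_Mapping.lookup x b - Poly_Mapping.lookup y b) * of_nat (mark G act u b)) = 0"
    if "u \<in> B" for u
    using fun_cong[OF eq, of u] that x y
    by (simp add: mem_free_module phi_eq_sum left_diff_distrib sum_subtractf)
  then have "Poly_Mapping.lookup x b - Poly_Mapping.lookup y b = 0" if "b \<in> B" for b
    using matrix_injective[of "\<lambda>b. Poly_Mapping.lookup x b - Poly_Mapping.lookup y b"] that by blast
  moreover have "Poly_Mapping.lookup x b = Poly_Mapping.lookup y b" if "b \<notin> B" for b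
    using x y that unfolding mem_free_module by (metis in_keys_iff subsetD)
  ultimately show "x = y" by (intro poly_mapping_eqI) (metis eq_iff_diff_eq_0)
qed

text \<open>The inclusion from left to right is Burnside's lemma for the basis elements; the converse is
  the peeling argument for triangular systems.\<close>

lemma phi_image: "phi G act B ` carrier (free_module p B) = {y \<in> carrier (Ghost p B). congruent y}"
proof (intro equalityI subsetI)
  fix y assume "y \<in> phi G act B ` carrier (free_module p B)"
  then obtain f where f: "f \<in> carrier (free_module p B)" "y = phi G act B f" by auto
  have "congruent (\<lambda>u. \<Sum>b\<in>B. Poly_Mapping.lookup f b * of_nat (mark G act u b))"
    using f by (intro congruent_sum congruent_cmult congruent_mark) (auto simp: mem_free_module)
  then have "congruent y"
    by (rule congruent_cong[rotated]) (use f in \<open>auto simp: mem_free_module phi_eq_sum\<close>)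
  then show "y \<in> {y \<in> carrier (Ghost p B). congruent y}"
    using f phi_linear by (auto simp: linear_maps_def)
next
  fix y assume y: "y \<in> {y \<in> carrier (Ghost p B). congruent y}"
  obtain x where x: "\<And>b. b \<in> B \<Longrightarrow> x b \<in> Zp"
    "\<And>u. u \<in> B \<Longrightarrow> y u = (\<Sum>b\<in>B. x b * of_nat (mark G act u b))"
    using congruent_imp_in_image[OF congruent_mark, of y] y by (auto simp: Ghost_simps PiE_iff)
  define f where "f = Poly_Mapping.Abs_poly_mapping (\<lambda>b. if b \<in> B then x b else 0)"
  have lookup_f: "Poly_Mapping.lookup f = (\<lambda>b. if b \<in> B then x b else 0)"
    unfolding f_def
  proof (rule lookup_Abs_poly_mapping, rule finite_subset[OF subsetI finite_B])
    fix b assume "b \<in> {b. (if b \<in> B then x b else 0) \<noteq> 0}"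
    then show "b \<in> B" by (cases "b \<in> B") simp_all
  qed
  have keys_f: "Poly_Mapping.keys f \<subseteq> B"
  proof
    fix b assume "b \<in> Poly_Mapping.keys f"
    then show "b \<in> B" by (cases "b \<in> B") (simp_all add: in_keys_iff lookup_f)
  qed
  have "f \<in> carrier (free_module p B)"
    using x(1) zero_A keys_f by (auto simp: mem_free_module lookup_f)
  moreover have "phi G act B f = y"
    using y x(2) unfolding phi_eq_sum[OF keys_f] lookup_f
    by (auto simp: Ghost_simps PiE_iff extensional_def fun_eq_iff)
  ultimately show "y \<in> phi G act B ` carrier (free_module p B)" by blast
qed

lemma phi_image_closed_mult:
  assumes "x \<in> carrier (free_module p B)" "y \<in> carrier (free_module p B)"
  shows "phi G act B x \<otimes>\<^bsub>Ghost p B\<^esub> phi G act B y \<in> phi G act B ` carrier (free_module p B)"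
proof -
  \<comment> \<open>Bilinearity reduces the product to products of two columns.\<close>
  have "congruent (\<lambda>u. \<Sum>b\<in>B. \<Sum>b'\<in>B. (Poly_Mapping.lookup x b * Poly_Mapping.lookup y b') *
      (of_nat (mark G act u b) * of_nat (mark G act u b')))"
    using assms mult_A
    by (intro congruent_sum congruent_cmult congruent_mark_mult) (auto simp: mem_free_module)
  then have "congruent (phi G act B x \<otimes>\<^bsub>Ghost p B\<^esub> phi G act B y)"
    by (rule congruent_cong[rotated])
      (use assms in \<open>auto simp: mem_free_module phi_eq_sum Ghost_simps sum_product algebra_simps\<close>)
  moreover have "phi G act B x \<otimes>\<^bsub>Ghost p B\<^esub> phi G act B y \<in> carrier (Ghost p B)"
  proof -
    interpret N: algebra "Zloc p" "Ghost p B" by (rule algebra_Ghost)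
    show ?thesis using assms phi_linear by (intro N.m_closed) (auto simp: linear_maps_def)
  qed
  ultimately show ?thesis by (simp add: phi_image)
qed

lemma one_in_phi_image: "\<one>\<^bsub>Ghost p B\<^esub> \<in> phi G act B ` carrier (free_module p B)"
proof -
  have "congruent \<one>\<^bsub>Ghost p B\<^esub>"
    by (rule congruent_cong[OF _ congruent_one]) (simp add: Ghost_simps)
  moreover have "\<one>\<^bsub>Ghost p B\<^esub> \<in> carrier (Ghost p B)"
    using of_int_in_Zloc[OF p, of 1] by (simp add: Ghost_simps)
  ultimately show ?thesis by (simp add: phi_image)
qed

lemma psi_eq:
  "psi p G act Lf \<XX> B Syl x =
    (\<lambda>u\<in>B. Obs_ideal p Syl u +>\<^bsub>Zloc p\<^esub> (\<Sum>C\<in>Syl u. x (closure_rep u C)))"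
  by (simp add: psi_def component_def closure_rep_def rep_def)

lemma sum_closure_rep_in_Zp:
  "x \<in> carrier (Ghost p B) \<Longrightarrow> u \<in> B \<Longrightarrow> (\<Sum>C\<in>Syl u. x (closure_rep u C)) \<in> Zp"
  using closure_rep_in_B by (intro sum_in_A) (auto simp: Ghost_simps PiE_iff)

lemma Obs_simps:
  "carrier (Obs p Syl B) = (\<Pi>\<^sub>E u\<in>B. carrier (Zloc p Quot Obs_ideal p Syl u))"
  "x \<oplus>\<^bsub>Obs p Syl B\<^esub> y = (\<lambda>u\<in>B. x u \<oplus>\<^bsub>Zloc p Quot Obs_ideal p Syl u\<^esub> y u)"
  "a \<odot>\<^bsub>Obs p Syl B\<^esub> x = (\<lambda>u\<in>B. (Obs_ideal p Syl u +>\<^bsub>Zloc p\<^esub> a)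
      \<otimes>\<^bsub>Zloc p Quot Obs_ideal p Syl u\<^esub> x u)"
  "\<zero>\<^bsub>Obs p Syl B\<^esub> = (\<lambda>u\<in>B. Obs_ideal p Syl u)"
  by (simp_all add: Obs_def prod_module_def quot_module_def FactRing_def)

lemma psi_linear: "psi p G act Lf \<XX> B Syl \<in> linear_maps (Zloc p) (Ghost p B) (Obs p Syl B)"
proof -
  note hom = ideal.rcos_ring_hom[OF ideal_Obs_ideal]
  note in_Zp = sum_closure_rep_in_Zp
  show ?thesis
    unfolding linear_maps_def
  proof (intro CollectI conjI ballI funcsetI)
    fix x assume "x \<in> carrier (Ghost p B)"
    then show "psi p G act Lf \<XX> B Syl x \<in> carrier (Obs p Syl B)"
      by (auto simp: psi_eq Obs_simps intro!: ring_hom_closed[OF hom] in_Zp)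
  next
    fix x y assume x: "x \<in> carrier (Ghost p B)" and y: "y \<in> carrier (Ghost p B)"
    have "(\<Sum>C\<in>Syl u. (x \<oplus>\<^bsub>Ghost p B\<^esub> y) (closure_rep u C)) =
        (\<Sum>C\<in>Syl u. x (closure_rep u C)) + (\<Sum>C\<in>Syl u. y (closure_rep u C))" if "u \<in> B" for u
      using closure_rep_in_B[OF that] by (simp add: Ghost_simps sum.distrib)
    then show "psi p G act Lf \<XX> B Syl (x \<oplus>\<^bsub>Ghost p B\<^esub> y) =
        psi p G act Lf \<XX> B Syl x \<oplus>\<^bsub>Obs p Syl B\<^esub> psi p G act Lf \<XX> B Syl y"
      using ring_hom_add[OF hom in_Zp[OF x] in_Zp[OF y]]
      unfolding psi_eq Obs_simps by (intro restrict_ext) simp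
  next
    fix a x assume a: "a \<in> Zp" and x: "x \<in> carrier (Ghost p B)"
    have "(\<Sum>C\<in>Syl u. (a \<odot>\<^bsub>Ghost p B\<^esub> x) (closure_rep u C)) =
        a * (\<Sum>C\<in>Syl u. x (closure_rep u C))" if "u \<in> B" for u
      using closure_rep_in_B[OF that] by (simp add: Ghost_simps sum_distrib_left)
    then show "psi p G act Lf \<XX> B Syl (a \<odot>\<^bsub>Ghost p B\<^esub> x) =
        a \<odot>\<^bsub>Obs p Syl B\<^esub> psi p G act Lf \<XX> B Syl x"
      using ring_hom_mult[OF hom a in_Zp[OF x]]
      unfolding psi_eq Obs_simps by (intro restrict_ext) simp
  qed
qed

lemma psi_kernel:
  "a_kernel (Ghost p B) (Obs p Syl B) (psi p G act Lf \<XX> B Syl) =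
    {y \<in> carrier (Ghost p B). congruent y}"
proof -
  have "psi p G act Lf \<XX> B Syl y = \<zero>\<^bsub>Obs p Syl B\<^esub> \<longleftrightarrow> congruent y"
    if y: "y \<in> carrier (Ghost p B)" for y
  proof -
    have "Obs_ideal p Syl u +>\<^bsub>Zloc p\<^esub> (\<Sum>C\<in>Syl u. y (closure_rep u C)) = Obs_ideal p Syl u \<longleftrightarrow>
        (\<exists>a\<in>Zp. (\<Sum>C\<in>Syl u. y (closure_rep u C)) = a * of_nat (card (Syl u)))" if "u \<in> B" for u
      using ideal.rcos_const_imp_mem[OF ideal_Obs_ideal sum_closure_rep_in_Zp[OF y that]]
        ring.a_rcos_zero[OF cring.axioms(1)[OF cring_Zloc[OF p]] ideal_Obs_ideal]
        mem_Obs_ideal by blast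
    then show ?thesis
      unfolding psi_eq Obs_simps congruent_def by (auto simp: restrict_def fun_eq_iff)
  qed
  then show ?thesis by (auto simp: a_kernel_def')
qed

lemma psi_surj: "psi p G act Lf \<XX> B Syl ` carrier (Ghost p B) = carrier (Obs p Syl B)"
proof (intro equalityI subsetI)
  fix w assume w: "w \<in> carrier (Obs p Syl B)"
  have "\<forall>u\<in>B. \<exists>z\<in>Zp. w u = Obs_ideal p Syl u +>\<^bsub>Zloc p\<^esub> z"
    using w by (auto simp: Obs_simps PiE_iff FactRing_def A_RCOSETS_def')
  then obtain z where z: "\<And>u. u \<in> B \<Longrightarrow> z u \<in> Zp \<and> w u = Obs_ideal p Syl u +>\<^bsub>Zloc p\<^esub> z u"
    by metis
  obtain y where y: "\<And>u. u \<in> B \<Longrightarrow> y u \<in> Zp"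
    "\<And>u. u \<in> B \<Longrightarrow> (\<Sum>C\<in>Syl u. y (closure_rep u C)) = z u"
    using congruence_operator_surj[of z] z by blast
  have "(\<Sum>C\<in>Syl u. restrict y B (closure_rep u C)) = z u" if "u \<in> B" for u
    using y(2)[OF that] closure_rep_in_B[OF that] by simp
  then have "psi p G act Lf \<XX> B Syl (restrict y B) = w"
    using z w by (auto simp: psi_eq Obs_simps PiE_iff extensional_def fun_eq_iff)
  moreover have "restrict y B \<in> carrier (Ghost p B)" using y by (auto simp: Ghost_simps)
  ultimately show "w \<in> psi p G act Lf \<XX> B Syl ` carrier (Ghost p B)" by blast
qed (use psi_linear in \<open>auto simp: linear_maps_def\<close>)

lemma short_exact:
  "short_exact_modules (Zloc p) (free_module p B) (Ghost p B) (Obs p Syl B)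
    (phi G act B) (psi p G act Lf \<XX> B Syl)"
  unfolding short_exact_modules_def
  using module_free_module[OF p] algebra.module[OF algebra_Ghost] module_Obs phi_linear psi_linear
    phi_inj psi_surj phi_image psi_kernel by simp

end

theorem theorem7p2:
  fixes p :: enat
    and G :: "('g, 'm) monoid_scheme"
    and act :: "'g \<Rightarrow> 'l::{finite,lattice} \<Rightarrow> 'l"
    and Lf :: "'g set \<Rightarrow> 'l set"
    and \<XX> R B :: "('g set \<times> 'l) set"
    and Syl :: "'g set \<times> 'l \<Rightarrow> 'g set set"
  assumes p: "p = \<infinity> \<or> (\<exists>q. p = enat q \<and> normalization_semidom_class.prime q)"
    and adm: "admissible_family G act Lf"
    and reps: "orbit_reps G act (pairs G Lf) R"
    and syl: "\<And>x. x \<in> pairs G Lf \<Longrightarrow> sylow_part p (Wgrp G act x) (Syl x)"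
    and B: "B = R \<inter> \<XX>"
    and X_sub: "\<XX> \<subseteq> pairs G Lf"
    and X_closed: "\<And>g x. g \<in> carrier G \<Longrightarrow> x \<in> \<XX> \<Longrightarrow> pact G act g x \<in> \<XX>"
    and X_min: "\<And>u g. u \<in> \<XX> \<Longrightarrow> g \<in> stabilizer G (pact G act) u
                  \<Longrightarrow> \<exists>!m. minimal_pair (upper_pairs G Lf \<XX> g u) m"
  shows "short_exact_modules (Zloc p) (free_module p B) (Ghost p B) (Obs p Syl B)
           (phi G act B) (psi p G act Lf \<XX> B Syl) \<and>
         (\<exists>m e. algebra (Zloc p) ((free_module p B)\<lparr>monoid.mult := m, one := e\<rparr>) \<and>
                algebra (Zloc p) (Ghost p B) \<and>
                phi G act B \<in> ring_hom ((free_module p B)\<lparr>monoid.mult := m, one := e\<rparr>) (Ghost p B) \<and>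
                phi G act B \<in> linear_maps (Zloc p) ((free_module p B)\<lparr>monoid.mult := m, one := e\<rparr>) (Ghost p B) \<and>
                inj_on (phi G act B) (carrier (free_module p B)))"
proof -
  interpret obstruction_data G act Lf \<XX> p R B Syl
    by (intro obstruction_data.intro pair_family.intro pair_family_axioms.intro
        obstruction_data_axioms.intro assms)
  obtain m e where "algebra (Zloc p) ((free_module p B)\<lparr>monoid.mult := m, one := e\<rparr>)"
    "phi G act B \<in> ring_hom ((free_module p B)\<lparr>monoid.mult := m, one := e\<rparr>) (Ghost p B)"
    "phi G act B \<in> linear_maps (Zloc p) ((free_module p B)\<lparr>monoid.mult := m, one := e\<rparr>) (Ghost p B)"
    by (rule algebra_transport[OF module_free_module[OF p] algebra_Ghost phi_linear phi_inj
        one_in_phi_image phi_image_closed_mult])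
  then show ?thesis using short_exact algebra_Ghost phi_inj by blast
qed

end
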